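(* Fix $\lambda>1$ independent of $\epsilon$, set $\mu:=\epsilon^2\lambda$ and let $c>0$ be given by $c^2=1+\epsilon^2\lambda$. Let $(w_{{\rm trav},\epsilon},p_{{\rm trav},\epsilon})$ be the travelling wave solution with speed $c$ (defined in the context) of the lattice equations $$\dot w_n=p_{n+1}-p_n,\qquad \dot p_n=\tilde V_\epsilon'(w_n)-\tilde V_\epsilon'(w_{n-1}),\qquad n\in\mathbb{Z}.$$ For every $\tau_0>0$ there exist positive constants $\epsilon_0$, $\delta_0$ and $C_0$ such that, for all $\epsilon\in(0,\epsilon_0)$, when initial data $(w_{{\rm ini},\epsilon},p_{{\rm ini},\epsilon})\in l^2(\mathbb{Z})\times l^2(\mathbb{Z})$ satisfy $$\delta:=\|w_{{\rm ini},\epsilon}-w_{{\rm trav},\epsilon}(0)\|_{l^2}+\|p_{{\rm ini},\epsilon}-p_{{\rm trav},\epsilon}(0)\|_{l^2}\leq\delta_0,$$ then the unique solution $(w_\epsilon,p_\epsilon)$ of the lattice equations with initial data $(w_{{\rm ini},\epsilon},p_{{\rm ini},\epsilon})$ at $t=0$ belongs to $C^1([-\tau_0\epsilon^{-3},\tau_0\epsilon^{-3}],l^2(\mathbb{Z}))$ (each component) and satisfies $$\|w_\epsilon(t)-w_{{\rm trav},\epsilon}(t)\|_{l^2}+\|p_\epsilon(t)-p_{{\rm trav},\epsilon}(t)\|_{l^2}\leq C_0\,\delta,\qquad t\in[-\tau_0\epsilon^{-3},\tau_0\epsilon^{-3}].$$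
   Context: For $\epsilon>0$ and $w>-1$, $$\tilde V_\epsilon(w):=\frac{1}{2+\epsilon^2}\left[(1+w)^{2+\epsilon^2}-1\right]-w,\qquad \tilde V_\epsilon'(w)=(1+w)^{1+\epsilon^2}-1.$$ The dot is the derivative in time $t$; solutions of the lattice equations have all components $w_n>-1$. Travelling wave. For $\lambda>1$ let $W_{\rm stat}\in H^\infty(\mathbb{R})=\bigcap_kH^k(\mathbb{R})$ be the unique positive and even $H^1(\mathbb{R})$ solution of $\lambda W=\frac{1}{12}W''+(1+W)\log(1+W)$ on $\mathbb{R}$. It is known that there exist $\epsilon_1,C_1>0$ such that for every $\epsilon\in(0,\epsilon_1)$ there is a unique even solution $w_{{\rm stat},\epsilon}\in L^2(\mathbb{R})\cap L^\infty(\mathbb{R})$ (with values in $(-1,\infty)$) of $$(1+\mu)w''(z)=\tilde V_\epsilon'(w(z+1))-2\tilde V_\epsilon'(w(z))+\tilde V_\epsilon'(w(z-1)),\quad z\in\mathbb{R},\quad \mu=\epsilon^2\lambda,$$ with $\sup_{z}|w_{{\rm stat},\epsilon}(z)-W_{\rm stat}(\epsilon z)|\leq C_1\epsilon^{1/6}$; moreover $w_{{\rm stat},\epsilon}\in H^\infty(\mathbb{R})$ and for every $k\in\mathbb{N}$ there is an $\epsilon$-independent constant $C'_k>0$ with $\sup_z|\partial_z^kw_{{\rm stat},\epsilon}(z)-\epsilon^k\partial_x^kW_{\rm stat}(\epsilon z)|\leq C'_k\epsilon^{k+1/6}$. Let $p_{{\rm stat},\epsilon}$ be the function found from the advance equation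 $-c\,w_{{\rm stat},\epsilon}'(z)=p_{{\rm stat},\epsilon}(z+1)-p_{{\rm stat},\epsilon}(z)$, for which $$(w_{{\rm trav},\epsilon})_n(t):=w_{{\rm stat},\epsilon}(n-ct),\qquad (p_{{\rm trav},\epsilon})_n(t):=p_{{\rm stat},\epsilon}(n-ct),\quad n\in\mathbb{Z},$$ defines a solution in $C^1(\mathbb{R},l^2(\mathbb{Z}))$ (each component) of the lattice equations; in particular $-c\,p_{{\rm stat},\epsilon}'(z)=\tilde V_\epsilon'(w_{{\rm stat},\epsilon}(z))-\tilde V_\epsilon'(w_{{\rm stat},\epsilon}(z-1))$. *)

theory Defs
  imports "HOL-Analysis.Analysis"
begin

section \<open>The Hilbert space of square-summable bi-infinite sequences\<close>

typedef ell2 = "{u :: int \<Rightarrow> real. (\<lambda>n. (u n)\<^sup>2) summable_on UNIV}"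
  morphisms coord Abs_ell2
  by (rule exI[of _ "\<lambda>_. 0"]) simp

setup_lifting type_definition_ell2

lemma ell2_mult_summable:
  fixes u v :: "int \<Rightarrow> real"
  assumes "(\<lambda>n. (u n)\<^sup>2) summable_on UNIV" "(\<lambda>n. (v n)\<^sup>2) summable_on UNIV"
  shows "(\<lambda>n. u n * v n) summable_on UNIV"
proof -
  have "(\<lambda>n. (u n)\<^sup>2 + (v n)\<^sup>2) summable_on UNIV"
    using assms by (rule summable_on_add)
  then have "(\<lambda>n. norm (u n * v n)) summable_on UNIV"
  proof (rule summable_on_comparison_test)
    fix n
    have "0 \<le> (\<bar>u n\<bar> - \<bar>v n\<bar>)\<^sup>2" "0 \<le> \<bar>u n\<bar> * \<bar>v n\<bar>" by simp_all
    then have "2 * (\<bar>u n\<bar> * \<bar>v n\<bar>) \<le> (u n)\<^sup>2 + (v n)\<^sup>2"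
      by (simp add: power2_diff)
    with \<open>0 \<le> \<bar>u n\<bar> * \<bar>v n\<bar>\<close> show "norm (u n * v n) \<le> (u n)\<^sup>2 + (v n)\<^sup>2"
      by (simp only: real_norm_def abs_mult)
  qed simp
  then show ?thesis by (rule abs_summable_summable)
qed

instantiation ell2 :: real_inner
begin

lift_definition zero_ell2 :: ell2 is "\<lambda>_. 0" by simp

lift_definition plus_ell2 :: "ell2 \<Rightarrow> ell2 \<Rightarrow> ell2" is "\<lambda>u v n. u n + v n"
  by (auto simp: power2_sum mult.assoc
      intro!: summable_on_add summable_on_cmult_right ell2_mult_summable)

lift_definition uminus_ell2 :: "ell2 \<Rightarrow> ell2" is "\<lambda>u n. - u n" by simp

lift_definition minus_ell2 :: "ell2 \<Rightarrow> ell2 \<Rightarrow> ell2" is "\<lambda>u v n. u n - v n"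
proof -
  fix u v :: "int \<Rightarrow> real"
  assume *: "(\<lambda>n. (u n)\<^sup>2) summable_on UNIV" "(\<lambda>n. (v n)\<^sup>2) summable_on UNIV"
  have "(\<lambda>n. (u n)\<^sup>2 + (v n)\<^sup>2 + (-2) * (u n * v n)) summable_on UNIV"
    by (intro summable_on_add summable_on_cmult_right ell2_mult_summable *)
  then show "(\<lambda>n. (u n - v n)\<^sup>2) summable_on UNIV"
    by (simp add: power2_diff mult.assoc)
qed

lift_definition scaleR_ell2 :: "real \<Rightarrow> ell2 \<Rightarrow> ell2" is "\<lambda>c u n. c * u n"
  by (auto simp: power_mult_distrib intro!: summable_on_cmult_right)

lift_definition inner_ell2 :: "ell2 \<Rightarrow> ell2 \<Rightarrow> real" is "\<lambda>u v. \<Sum>\<^sub>\<infinity>n. u n * v n" .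

lift_definition norm_ell2 :: "ell2 \<Rightarrow> real" is "\<lambda>u. sqrt (\<Sum>\<^sub>\<infinity>n. (u n)\<^sup>2)" .

definition dist_ell2 :: "ell2 \<Rightarrow> ell2 \<Rightarrow> real" where
  "dist_ell2 u v = norm (u - v)"

definition sgn_ell2 :: "ell2 \<Rightarrow> ell2" where
  "sgn_ell2 u = inverse (norm u) *\<^sub>R u"

definition uniformity_ell2 :: "(ell2 \<times> ell2) filter" where
  "uniformity_ell2 = (INF e\<in>{0<..}. principal {(u, v). dist u v < e})"

definition open_ell2 :: "ell2 set \<Rightarrow> bool" where
  "open_ell2 U \<longleftrightarrow> (\<forall>u\<in>U. eventually (\<lambda>(u', v). u' = u \<longrightarrow> v \<in> U) uniformity)"

instance
proof
  fix u v w :: ell2 and a b :: real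
  show "u + v + w = u + (v + w)" by transfer (simp add: add.assoc)
  show "u + v = v + u" by transfer (simp add: add.commute)
  show "0 + u = u" by transfer simp
  show "- u + u = 0" by transfer simp
  show "u - v = u + - v" by transfer simp
  show "a *\<^sub>R (u + v) = a *\<^sub>R u + a *\<^sub>R v" by transfer (simp add: algebra_simps)
  show "(a + b) *\<^sub>R u = a *\<^sub>R u + b *\<^sub>R u" by transfer (simp add: algebra_simps)
  show "a *\<^sub>R b *\<^sub>R u = (a * b) *\<^sub>R u" by transfer (simp add: algebra_simps)
  show "1 *\<^sub>R u = u" by transfer simp
  show "dist u v = norm (u - v)" by (rule dist_ell2_def)
  show "sgn u = inverse (norm u) *\<^sub>R u" by (rule sgn_ell2_def)
  show "(uniformity :: (ell2 \<times> ell2) filter) = (INF e\<in>{0<..}. principal {(u, v). dist u v < e})"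
    by (rule uniformity_ell2_def)
  show "open U \<longleftrightarrow> (\<forall>u\<in>U. eventually (\<lambda>(u', v). u' = u \<longrightarrow> v \<in> U) uniformity)" for U :: "ell2 set"
    by (rule open_ell2_def)
  show "inner u v = inner v u" by transfer (simp add: mult.commute)
  show "inner (u + v) w = inner u w + inner v w"
    by transfer (simp add: distrib_right infsum_add ell2_mult_summable)
  show "inner (a *\<^sub>R u) v = a * inner u v"
    by transfer (simp add: mult.assoc infsum_cmult_right')
  show "0 \<le> inner u u" by transfer (simp add: infsum_nonneg)
  show "inner u u = 0 \<longleftrightarrow> u = 0"
  proof
    assume "inner u u = 0"
    then show "u = 0"
    proof transfer
      fix u :: "int \<Rightarrow> real"
      assume s: "(\<lambda>n. (u n)\<^sup>2) summable_on UNIV" and z: "(\<Sum>\<^sub>\<infinity>n. u n * u n) = 0"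
      have "(u n)\<^sup>2 = 0" for n
        by (rule nonneg_infsum_le_0D[where A = UNIV])
          (use s z in \<open>auto simp: power2_eq_square\<close>)
      then show "u = (\<lambda>_. 0)" by auto
    qed
  next
    assume "u = 0"
    then show "inner u u = 0" by transfer simp
  qed
  show "norm u = sqrt (inner u u)" by transfer (simp add: power2_eq_square)
qed

end

section \<open>Function spaces on the real line\<close>

definition times_differentiable :: "nat \<Rightarrow> (real \<Rightarrow> real) \<Rightarrow> bool" where
  "times_differentiable k f \<longleftrightarrow> (\<forall>j<k. \<forall>x. (deriv ^^ j) f field_differentiable (at x))"

definition smooth :: "(real \<Rightarrow> real) \<Rightarrow> bool" where
  "smooth f \<longleftrightarrow> (\<forall>k. times_differentiable k f)"

definition L2_space :: "(real \<Rightarrow> real) set" where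
  "L2_space = {f. f \<in> borel_measurable lebesgue \<and> integrable lebesgue (\<lambda>x. (f x)\<^sup>2)}"

definition Linf_space :: "(real \<Rightarrow> real) set" where
  "Linf_space = {f. f \<in> borel_measurable lebesgue \<and> (\<exists>B. AE x in lebesgue. \<bar>f x\<bar> \<le> B)}"

definition test_function :: "(real \<Rightarrow> real) \<Rightarrow> bool" where
  "test_function \<phi> \<longleftrightarrow> smooth \<phi> \<and> compact (closure {x. \<phi> x \<noteq> 0})"

text \<open>Only used for \<open>f\<close> and \<open>g\<close> in \<open>L2_space\<close>, where both integrals exist.\<close>

definition weak_derivative :: "(real \<Rightarrow> real) \<Rightarrow> (real \<Rightarrow> real) \<Rightarrow> bool" where
  "weak_derivative f g \<longleftrightarrow>
    (\<forall>\<phi>. test_function \<phi> \<longrightarrow>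
      (LINT x|lebesgue. f x * deriv \<phi> x) = - (LINT x|lebesgue. g x * \<phi> x))"

primrec Sobolev :: "nat \<Rightarrow> (real \<Rightarrow> real) set" where
  "Sobolev 0 = L2_space"
| "Sobolev (Suc k) = {f \<in> L2_space. \<exists>g\<in>Sobolev k. weak_derivative f g}"

definition Sobolev_inf :: "(real \<Rightarrow> real) set" where
  "Sobolev_inf = (\<Inter>k. Sobolev k)"

section \<open>The potential and the lattice equations\<close>

definition V :: "real \<Rightarrow> real \<Rightarrow> real" where
  "V \<epsilon> w = 1 / (2 + \<epsilon>\<^sup>2) * ((1 + w) powr (2 + \<epsilon>\<^sup>2) - 1) - w"

definition V' :: "real \<Rightarrow> real \<Rightarrow> real" where
  "V' \<epsilon> w = (1 + w) powr (1 + \<epsilon>\<^sup>2) - 1"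

lemma V_has_derivative:
  assumes "w > -1"
  shows "(V \<epsilon> has_real_derivative V' \<epsilon> w) (at w)"
proof -
  have pos: "2 + \<epsilon>\<^sup>2 > 0" by (simp add: add_pos_nonneg)
  have "((\<lambda>w. (1 + w) powr (2 + \<epsilon>\<^sup>2)) has_real_derivative
      (2 + \<epsilon>\<^sup>2) * (1 + w) powr (1 + \<epsilon>\<^sup>2)) (at w)"
    using assms by (auto intro!: derivative_eq_intros simp: algebra_simps)
  then have "((\<lambda>w. 1 / (2 + \<epsilon>\<^sup>2) * ((1 + w) powr (2 + \<epsilon>\<^sup>2) - 1) - w) has_real_derivative
      1 / (2 + \<epsilon>\<^sup>2) * ((2 + \<epsilon>\<^sup>2) * (1 + w) powr (1 + \<epsilon>\<^sup>2) - 0) - 1) (at w)"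
    by (intro DERIV_diff DERIV_cmult DERIV_const DERIV_ident)
  then show ?thesis
    using pos by (simp add: V_def [abs_def] V'_def)
qed

text \<open>One-sided derivatives are meant at the endpoints of an interval, so
  \<open>C1_differentiable_on\<close> (which uses two-sided derivatives) does not apply.\<close>

definition C1_on :: "real set \<Rightarrow> (real \<Rightarrow> ell2) \<Rightarrow> bool" where
  "C1_on I u \<longleftrightarrow>
    (\<exists>u'. (\<forall>t\<in>I. (u has_vector_derivative u' t) (at t within I)) \<and> continuous_on I u')"

definition lattice_solution ::
    "real \<Rightarrow> real set \<Rightarrow> (real \<Rightarrow> ell2) \<Rightarrow> (real \<Rightarrow> ell2) \<Rightarrow> bool" where
  "lattice_solution \<epsilon> I w p \<longleftrightarrow>
    C1_on I w \<and> C1_on I p \<and>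
    (\<forall>t\<in>I. \<forall>n.
      coord (w t) n > -1 \<and>
      ((\<lambda>s. coord (w s) n) has_real_derivative
         (coord (p t) (n + 1) - coord (p t) n)) (at t within I) \<and>
      ((\<lambda>s. coord (p s) n) has_real_derivative
         (V' \<epsilon> (coord (w t) n) - V' \<epsilon> (coord (w t) (n - 1)))) (at t within I))"

section \<open>Travelling-wave profiles\<close>

definition wave_speed :: "real \<Rightarrow> real \<Rightarrow> real" where
  "wave_speed lam \<epsilon> = sqrt (1 + \<epsilon>\<^sup>2 * lam)"

text \<open>Elements of Lebesgue and Sobolev classes are represented by genuine functions. A
  distributional solution of either profile equation has a twice differentiable
  representative, which solves the equation pointwise; the predicates below select that
  representative, so that a uniqueness claim can be stated as equality of functions.\<close>

definition limit_profile :: "real \<Rightarrow> (real \<Rightarrow> real) \<Rightarrow> bool" where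
  "limit_profile lam W \<longleftrightarrow>
    W \<in> Sobolev 1 \<and> times_differentiable 2 W \<and>
    (\<forall>x. W x > 0) \<and> (\<forall>x. W (- x) = W x) \<and>
    (\<forall>x. lam * W x = 1 / 12 * (deriv ^^ 2) W x + (1 + W x) * ln (1 + W x))"

definition stationary_profile ::
    "real \<Rightarrow> (real \<Rightarrow> real) \<Rightarrow> real \<Rightarrow> real \<Rightarrow> (real \<Rightarrow> real) \<Rightarrow> bool" where
  "stationary_profile lam W C1 \<epsilon> w \<longleftrightarrow>
    w \<in> L2_space \<inter> Linf_space \<and> times_differentiable 2 w \<and>
    (\<forall>z. w z > -1) \<and> (\<forall>z. w (- z) = w z) \<and>
    (\<forall>z. (1 + \<epsilon>\<^sup>2 * lam) * (deriv ^^ 2) w z =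
          V' \<epsilon> (w (z + 1)) - 2 * V' \<epsilon> (w z) + V' \<epsilon> (w (z - 1))) \<and>
    (\<forall>z. \<bar>w z - W (\<epsilon> * z)\<bar> \<le> C1 * \<epsilon> powr (1 / 6))"

end

theory Submission imports Defs begin

text \<open>
  The travelling wave is stable over times of order \<open>\<epsilon>\<^sup>-\<^sup>3\<close> because the energy of a perturbation,
  measured relative to the wave, grows only at a rate of order \<open>\<epsilon>\<^sup>3\<close>. Let \<open>(v, r)\<close> be the wave,
  \<open>(w, p)\<close> another solution, and
    \<open>E = (norm (p - r))\<^sup>2 / 2 + (\<Sum>n. V w\<^sub>n - V v\<^sub>n - V' v\<^sub>n (w\<^sub>n - v\<^sub>n))\<close>,
  the total energy of \<open>(w, p)\<close> minus its first-order Taylor polynomial at \<open>(v, r)\<close>. Where \<open>V''\<close>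
  lies between two positive constants, \<open>E\<close> is equivalent to the squared distance of the two
  solutions. In \<open>E'\<close> everything cancels by summation by parts except
    \<open>E' = (\<Sum>n. (V' w\<^sub>n - V' v\<^sub>n - V'' v\<^sub>n (w\<^sub>n - v\<^sub>n)) v\<^sub>n')\<close>,
  which is small for two independent reasons. The potential is nearly harmonic, \<open>V''' = O(\<epsilon>\<^sup>2)\<close>, so
  the bracket is \<open>O(\<epsilon>\<^sup>2)\<close> times the square of the perturbation; and the wave is long, its profile
  being close to \<open>W (\<epsilon> z)\<close>, so \<open>v\<^sub>n' = O(\<epsilon>)\<close>. Hence \<open>\<bar>E'\<bar> \<le> C \<epsilon>\<^sup>3 E\<close>, and Gronwall's inequality
  bounds \<open>E\<close> by a constant multiple of its initial value for \<open>\<bar>t\<bar> \<le> \<tau> / \<epsilon>\<^sup>3\<close>. This is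
  \<open>relative_energy_derivative\<close> and \<open>stability_of_slow_solutions\<close>.

  Existence on the long interval would normally be a continuation argument, since \<open>V'\<close> is only
  locally Lipschitz and the components must stay above \<open>-1\<close>. Here it is replaced by a
  modification of the force: \<open>V'\<close> is kept on the range of values that occurs near the wave and
  continued linearly outside it (\<open>truncated_potential\<close>). The modified lattice has a globally
  Lipschitz vector field on \<open>ell2 \<times> ell2\<close>, so its solutions are global (\<open>chain_flow_exists\<close>), and
  the energy estimate holds for it unconditionally. For small initial perturbations the estimate
  then confines the solution to the range in which nothing was modified, so that it solves the
  original lattice equations. Uniqueness is a Gronwall estimate for the squared \<open>ell2\<close> distance;
  it concerns arbitrary solutions, which are bounded on the compact time interval but need not
  stay in that range.

  The uniform bounds on the wave come from the limit profile \<open>W\<close>: it is bounded because one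
  lattice profile is essentially bounded and close to it, its second derivative is bounded by its
  differential equation, and its first derivative by interpolation (\<open>limit_profile_bounds\<close>).
\<close>

section \<open>Square-summable sequences as a Banach space\<close>

lemmas coord_simps [simp] =
  zero_ell2.rep_eq plus_ell2.rep_eq minus_ell2.rep_eq uminus_ell2.rep_eq scaleR_ell2.rep_eq

lemma ell2_eqI: "(\<And>n. coord u n = coord v n) \<Longrightarrow> u = v"
  by (metis coord_inject ext)

lemma square_summable_coord: "(\<lambda>n. (coord u n)\<^sup>2) summable_on UNIV"
  using coord[of u] by simp

lemma summable_coord_mult: "(\<lambda>n. coord u n * coord v n) summable_on UNIV"
  by (intro ell2_mult_summable square_summable_coord)

lemma norm_ell2_square: "(norm u)\<^sup>2 = (\<Sum>\<^sub>\<infinity>n. (coord u n)\<^sup>2)"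
  by (simp add: norm_ell2.rep_eq infsum_nonneg)

lemma sum_square_coord_le:
  assumes "finite F"
  shows "(\<Sum>n\<in>F. (coord u n)\<^sup>2) \<le> (norm u)\<^sup>2"
  unfolding norm_ell2_square
  by (rule finite_sum_le_infsum) (use assms in \<open>auto intro: square_summable_coord\<close>)

lemma abs_coord_le_norm: "\<bar>coord u n\<bar> \<le> norm u"
proof -
  have "(coord u n)\<^sup>2 \<le> (norm u)\<^sup>2"
    using sum_square_coord_le[of "{n}" u] by simp
  then show ?thesis
    using abs_le_square_iff[of "coord u n" "norm u"] by simp
qed

lemma bounded_linear_coord: "bounded_linear (\<lambda>u. coord u n)"
  by (rule bounded_linear_intro[where K = 1]) (auto simp: abs_coord_le_norm)

lemma coord_has_real_derivative:
  assumes "(u has_vector_derivative d) (at t within I)"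
  shows "((\<lambda>s. coord (u s) n) has_real_derivative coord d n) (at t within I)"
  using bounded_linear.has_vector_derivative[OF bounded_linear_coord assms]
  by (simp add: has_real_derivative_iff_has_vector_derivative)

text \<open>Bounds on finite partial sums survive coordinatewise limits; this makes the next lemma the
  tool for completeness.\<close>

lemma ell2_of_bounded_sums:
  fixes x :: "int \<Rightarrow> real"
  assumes "\<And>F. finite F \<Longrightarrow> (\<Sum>n\<in>F. (x n)\<^sup>2) \<le> B\<^sup>2" and "0 \<le> B"
  obtains u where "\<And>n. coord u n = x n" and "norm u \<le> B"
proof -
  have s: "(\<lambda>n. (x n)\<^sup>2) summable_on UNIV"
    by (rule nonneg_bdd_above_summable_on) (use assms in \<open>auto simp: bdd_above_def\<close>)
  then have c: "coord (Abs_ell2 x) = x"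
    by (simp add: Abs_ell2_inverse)
  have "(norm (Abs_ell2 x))\<^sup>2 \<le> B\<^sup>2"
    unfolding norm_ell2_square c by (rule infsum_le_finite_sums[OF s]) (use assms in auto)
  then have "norm (Abs_ell2 x) \<le> B"
    using assms(2) by (rule power2_le_imp_le)
  with c that show thesis by metis
qed

text \<open>Pointwise operations preserve \<open>ell2\<close> when they grow at most linearly; the superposition
  operators below are instances.\<close>

lemma ell2_of_dominated:
  fixes x :: "int \<Rightarrow> real"
  assumes "\<And>n. \<bar>x n\<bar> \<le> C * \<bar>coord v n\<bar>" and "0 \<le> C"
  obtains u where "\<And>n. coord u n = x n" and "norm u \<le> C * norm v"
proof (rule ell2_of_bounded_sums)
  fix F :: "int set"
  assume F: "finite F"
  have "(x n)\<^sup>2 \<le> C\<^sup>2 * (coord v n)\<^sup>2" for n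
    using power_mono[OF assms(1)[of n], of 2] by (simp add: power_mult_distrib)
  then have "(\<Sum>n\<in>F. (x n)\<^sup>2) \<le> C\<^sup>2 * (\<Sum>n\<in>F. (coord v n)\<^sup>2)"
    unfolding sum_distrib_left by (rule sum_mono)
  also have "\<dots> \<le> C\<^sup>2 * (norm v)\<^sup>2"
    by (intro mult_left_mono sum_square_coord_le F) simp
  finally show "(\<Sum>n\<in>F. (x n)\<^sup>2) \<le> (C * norm v)\<^sup>2"
    by (simp add: power_mult_distrib)
qed (use assms(2) that in auto)

lemma norm_le_of_coord_le:
  assumes "\<And>n. \<bar>coord u n\<bar> \<le> C * \<bar>coord v n\<bar>" and "0 \<le> C"
  shows "norm u \<le> C * norm v"
  using ell2_of_dominated[OF assms] by (metis ell2_eqI)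

instance ell2 :: banach
proof
  fix X :: "nat \<Rightarrow> ell2"
  assume X: "Cauchy X"
  define x where "x n = lim (\<lambda>m. coord (X m) n)" for n
  have x: "(\<lambda>m. coord (X m) n) \<longlonglongrightarrow> x n" for n
  proof -
    have "Cauchy (\<lambda>m. coord (X m) n)"
      by (rule bounded_linear.Cauchy[OF bounded_linear_coord X])
    then show ?thesis
      by (simp add: x_def Cauchy_convergent_iff convergent_LIMSEQ_iff)
  qed
  \<comment> \<open>The Cauchy estimate survives the passage to the limit in every finite partial sum.\<close>
  have close: "\<exists>v. (\<forall>n. coord v n = coord (X m) n - x n) \<and> norm v \<le> e"
    if m: "\<And>k. M \<le> k \<Longrightarrow> norm (X m - X k) \<le> e" and "0 \<le> e" for m M e
  proof -
    have "(\<Sum>n\<in>F. (coord (X m) n - x n)\<^sup>2) \<le> e\<^sup>2" if F: "finite F" for F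
    proof (rule tendsto_upperbound)
      show "(\<lambda>k. \<Sum>n\<in>F. (coord (X m) n - coord (X k) n)\<^sup>2)
          \<longlonglongrightarrow> (\<Sum>n\<in>F. (coord (X m) n - x n)\<^sup>2)"
        by (intro tendsto_intros x)
      show "\<forall>\<^sub>F k in sequentially. (\<Sum>n\<in>F. (coord (X m) n - coord (X k) n)\<^sup>2) \<le> e\<^sup>2"
      proof (rule eventually_sequentiallyI[of M])
        fix k assume "M \<le> k"
        have "(\<Sum>n\<in>F. (coord (X m) n - coord (X k) n)\<^sup>2) \<le> (norm (X m - X k))\<^sup>2"
          using sum_square_coord_le[OF F, of "X m - X k"] by simp
        also have "\<dots> \<le> e\<^sup>2"
          using m[OF \<open>M \<le> k\<close>] by (simp add: power_mono)
        finally show "(\<Sum>n\<in>F. (coord (X m) n - coord (X k) n)\<^sup>2) \<le> e\<^sup>2" .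
      qed
    qed simp
    then show ?thesis
      using ell2_of_bounded_sums[of "\<lambda>n. coord (X m) n - x n" e] \<open>0 \<le> e\<close> by metis
  qed
  have cauchy: "\<exists>M. \<forall>m\<ge>M. \<forall>k\<ge>M. norm (X m - X k) \<le> e" if "0 < e" for e
    using X that unfolding Cauchy_def dist_norm by (meson less_imp_le)
  obtain M where "\<forall>m\<ge>M. \<forall>k\<ge>M. norm (X m - X k) \<le> 1"
    using cauchy[of 1] by auto
  then obtain v where v: "\<And>n. coord v n = coord (X M) n - x n"
    using close[of M M 1] by auto
  define Y where "Y = X M - v"
  have Y: "coord Y n = x n" for n
    by (simp add: Y_def v)
  have "X \<longlonglongrightarrow> Y"
  proof (rule metric_LIMSEQ_I)
    fix r :: real assume "0 < r"
    obtain N where N: "\<forall>m\<ge>N. \<forall>k\<ge>N. norm (X m - X k) \<le> r / 2"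
      using cauchy[of "r / 2"] \<open>0 < r\<close> by auto
    have "dist (X m) Y < r" if m: "N \<le> m" for m
    proof -
      obtain d where d: "\<forall>n. coord d n = coord (X m) n - x n" "norm d \<le> r / 2"
        using close[of N m "r / 2"] N m \<open>0 < r\<close> by (meson half_gt_zero less_imp_le)
      have "d = X m - Y"
        by (rule ell2_eqI) (simp add: d Y)
      with d \<open>0 < r\<close> show ?thesis
        by (simp add: dist_norm)
    qed
    then show "\<exists>N. \<forall>m\<ge>N. dist (X m) Y < r" by blast
  qed
  then show "convergent X"
    by (rule convergentI)
qed

lift_definition shift :: "int \<Rightarrow> ell2 \<Rightarrow> ell2" is "\<lambda>k u n. u (n + k)"
proof -
  fix k :: int and u :: "int \<Rightarrow> real"
  assume "(\<lambda>n. (u n)\<^sup>2) summable_on UNIV"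
  moreover have "bij (\<lambda>n. n + k)"
    by (rule bij_betw_byWitness[where f' = "\<lambda>n. n - k"]) auto
  ultimately show "(\<lambda>n. (u (n + k))\<^sup>2) summable_on UNIV"
    using summable_on_reindex_bij_betw[of "\<lambda>n. n + k" UNIV UNIV "\<lambda>n. (u n)\<^sup>2"] by simp
qed

lemmas coord_shift [simp] = shift.rep_eq

text \<open>Summation by parts: the adjoint of a shift is the opposite shift.\<close>

lemma inner_shift: "inner (shift k u) v = inner u (shift (- k) v)"
  unfolding inner_ell2.rep_eq coord_shift
  by (rule infsum_reindex_bij_witness[of _ "\<lambda>n. n - k" "\<lambda>n. n + k"]) auto

lemma norm_shift: "norm (shift k u) = norm u"
proof -
  have "inner (shift k u) (shift k u) = inner u u"
    unfolding inner_shift by (rule arg_cong[of _ _ "inner u"], rule ell2_eqI) simp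
  then show ?thesis by (simp add: norm_eq_sqrt_inner)
qed

lemma bounded_linear_shift: "bounded_linear (shift k)"
proof (rule bounded_linear_intro[where K = 1])
  show "norm (shift k u) \<le> norm u * 1" for u
    by (simp add: norm_shift)
qed (rule ell2_eqI; simp)+

lemma shift_diff: "shift k (u - v) = shift k u - shift k v"
  by (rule ell2_eqI) simp

lemma norm_shift_minus_self_le: "norm (shift k u - u) \<le> 2 * norm u"
  using norm_triangle_ineq4[of "shift k u" u] by (simp add: norm_shift)

section \<open>Differential equations with Lipschitz right-hand side\<close>

lemma antiderivative_of_continuous:
  fixes g :: "real \<Rightarrow> 'a::banach"
  assumes g: "continuous_on UNIV g"
  shows "\<exists>J. J 0 = 0 \<and> (\<forall>t. (J has_vector_derivative g t) (at t))"
proof -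
  \<comment> \<open>The oriented integral from \<open>0\<close> to \<open>t\<close>: for \<open>t \<noteq> 0\<close> one of the two intervals is empty.\<close>
  define J where "J t = integral {0..t} g - integral {t..0} g" for t
  have int: "g integrable_on {a..b}" for a b
    by (rule integrable_continuous_real) (rule continuous_on_subset[OF g], simp)
  have "(J has_vector_derivative g t) (at t)" for t
  proof -
    define a b where "a = - \<bar>t\<bar> - 1" and "b = \<bar>t\<bar> + 1"
    have ab: "a < t" "t < b" "a < 0" "0 < b"
      by (auto simp: a_def b_def)
    have "((\<lambda>s. integral {a..s} g) has_vector_derivative g t) (at t within {a..b})"
      by (rule integral_has_vector_derivative) (use g ab continuous_on_subset in auto)
    then have "((\<lambda>s. integral {a..s} g) has_vector_derivative g t) (at t)"
      using ab by (simp add: at_within_Icc_at)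
    then have "((\<lambda>s. integral {a..s} g - integral {a..0} g) has_vector_derivative g t) (at t)"
      by (auto intro!: derivative_eq_intros)
    then show ?thesis
    proof (rule has_vector_derivative_transform_within_open[of _ _ _ "{a<..<b}"])
      fix s assume s: "s \<in> {a<..<b}"
      show "integral {a..s} g - integral {a..0} g = J s"
      proof (cases "0 \<le> s")
        case True
        then show ?thesis
          using Henstock_Kurzweil_Integration.integral_combine[of a 0 s g] int ab
          by (cases "s = 0") (auto simp: J_def algebra_simps)
      next
        case False
        then show ?thesis
          using Henstock_Kurzweil_Integration.integral_combine[of a s 0 g] int s
          by (auto simp: J_def algebra_simps)
      qed
    qed (use ab in auto)
  qed
  then show ?thesis
    by (intro exI[of _ J]) (auto simp: J_def)
qed

text \<open>Integration gains a factor \<open>1 / K\<close> on functions of growth \<open>exp (K \<bar>t\<bar>)\<close>. This gain is what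
  makes the Picard operator contract in a weighted norm on the whole line.\<close>

lemma norm_le_exp_of_derivative_le_nonneg:
  fixes J g :: "real \<Rightarrow> 'a::real_normed_vector"
  assumes J: "J 0 = 0" "\<And>t. (J has_vector_derivative g t) (at t)"
    and g: "\<And>t. norm (g t) \<le> M * exp (K * \<bar>t\<bar>)"
    and K: "0 < K" and t: "0 \<le> t"
  shows "norm (J t) \<le> M / K * exp (K * \<bar>t\<bar>)"
proof -
  have "0 \<le> M"
    using order_trans[OF norm_ge_zero g[of 0]] by simp
  have "norm (J t - J 0) \<le> M / K * exp (K * t) - M / K * exp (K * 0)"
  proof (cases "t = 0")
    case False
    show ?thesis
    proof (rule differentiable_bound_general)
      show "continuous_on {0..t} J"
        by (meson J(2) continuous_at_imp_continuous_on has_vector_derivative_continuous)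
      show "((\<lambda>t. M / K * exp (K * t)) has_vector_derivative M * exp (K * s)) (at s)" for s
        unfolding has_real_derivative_iff_has_vector_derivative[symmetric]
        using K by (auto intro!: derivative_eq_intros)
      show "norm (g s) \<le> M * exp (K * s)" if "0 < s" for s
        using g[of s] that by simp
    qed (use False t J K in \<open>auto intro!: continuous_intros\<close>)
  qed simp
  also have "\<dots> \<le> M / K * exp (K * t)"
    using K \<open>0 \<le> M\<close> by simp
  finally show ?thesis
    using J t by simp
qed

lemma norm_le_exp_of_derivative_le:
  fixes J g :: "real \<Rightarrow> 'a::real_normed_vector"
  assumes J: "J 0 = 0" "\<And>t. (J has_vector_derivative g t) (at t)"
    and g: "\<And>t. norm (g t) \<le> M * exp (K * \<bar>t\<bar>)"
    and K: "0 < K"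
  shows "norm (J t) \<le> M / K * exp (K * \<bar>t\<bar>)"
proof (cases "0 \<le> t")
  case True
  with assms show ?thesis by (rule norm_le_exp_of_derivative_le_nonneg)
next
  case False
  have "norm (J (- (- t))) \<le> M / K * exp (K * \<bar>- t\<bar>)"
  proof (rule norm_le_exp_of_derivative_le_nonneg)
    show "((\<lambda>s. J (- s)) has_vector_derivative - g (- s)) (at s)" for s
    proof -
      have "((\<lambda>s. - s) has_vector_derivative - 1) (at s)"
        by (auto intro!: derivative_eq_intros)
      from vector_diff_chain_at[OF this J(2)[of "- s"]] show ?thesis
        by (simp add: o_def)
    qed
    show "norm (- g (- s)) \<le> M * exp (K * \<bar>s\<bar>)" for s
      using g[of "- s"] by simp
  qed (use J K False in auto)
  then show ?thesis by simp
qed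

text \<open>The Picard operator is contracting on the whole time axis at once when curves are compared in
  the norm \<open>sup\<^sub>t exp (- 2 L \<bar>t\<bar>) norm (x t)\<close>, so no gluing of local solutions is needed. In the
  proof, the bounded continuous \<open>y\<close> stands for the rescaled curve \<open>exp (- K \<bar>t\<bar>) x t\<close>.\<close>

theorem global_solution_of_lipschitz_field:
  fixes F :: "'a::banach \<Rightarrow> 'a"
  assumes lip: "\<And>x y. norm (F x - F y) \<le> L * norm (x - y)" and L: "0 < L"
  shows "\<exists>x. x 0 = x0 \<and> (\<forall>t. (x has_vector_derivative F (x t)) (at t))"
proof -
  define K where "K = 2 * L"
  have K: "0 < K"
    using L by (simp add: K_def)
  have cont_F: "continuous_on S F" for S
  proof (rule continuous_on_subset)
    show "continuous_on UNIV F"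
      by (rule lipschitz_on_continuous_on[of L]) (use lip L in \<open>auto simp: lipschitz_on_def dist_norm\<close>)
  qed simp
  define G :: "(real \<Rightarrow>\<^sub>C 'a) \<Rightarrow> real \<Rightarrow> 'a" where
    "G y t = F (exp (K * \<bar>t\<bar>) *\<^sub>R apply_bcontfun y t)" for y t
  have cont_G: "continuous_on UNIV (G y)" for y
    unfolding G_def by (intro continuous_on_compose2[OF cont_F] continuous_intros) auto
  have "\<forall>y. \<exists>J. J 0 = 0 \<and> (\<forall>t. (J has_vector_derivative G y t) (at t))"
    using antiderivative_of_continuous[OF cont_G] by blast
  then obtain J where J: "\<And>y. J y 0 = 0" "\<And>y t. (J y has_vector_derivative G y t) (at t)"
    by metis
  have J_bound: "norm (J y t) \<le> (norm (F 0) + L * norm y) / K * exp (K * \<bar>t\<bar>)" for y t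
  proof (rule norm_le_exp_of_derivative_le[OF J _ K])
    fix s
    have "norm (G y s) \<le> norm (F 0) + L * norm (exp (K * \<bar>s\<bar>) *\<^sub>R apply_bcontfun y s)"
      using lip[of "exp (K * \<bar>s\<bar>) *\<^sub>R apply_bcontfun y s" 0] norm_triangle_sub[of "G y s" "F 0"]
      by (simp add: G_def)
    also have "\<dots> \<le> norm (F 0) * exp (K * \<bar>s\<bar>) + L * (exp (K * \<bar>s\<bar>) * norm y)"
      using L K by (intro add_mono mult_left_mono) (auto simp: norm_bounded mult_le_cancel_left1)
    finally show "norm (G y s) \<le> (norm (F 0) + L * norm y) * exp (K * \<bar>s\<bar>)"
      by (simp add: algebra_simps)
  qed
  have J_diff: "norm (J y t - J z t) \<le> L * norm (y - z) / K * exp (K * \<bar>t\<bar>)" for y z t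
  proof (rule norm_le_exp_of_derivative_le[OF _ _ _ K])
    show "((\<lambda>t. J y t - J z t) has_vector_derivative G y s - G z s) (at s)" for s
      by (intro derivative_intros J)
    fix s
    have "norm (G y s - G z s) \<le> L * norm (exp (K * \<bar>s\<bar>) *\<^sub>R apply_bcontfun (y - z) s)"
      using lip[of "exp (K * \<bar>s\<bar>) *\<^sub>R apply_bcontfun y s" "exp (K * \<bar>s\<bar>) *\<^sub>R apply_bcontfun z s"]
      by (simp add: G_def scaleR_diff_right)
    also have "\<dots> \<le> L * (exp (K * \<bar>s\<bar>) * norm (y - z))"
      using L norm_bounded[of "y - z" s] by (intro mult_left_mono) auto
    finally show "norm (G y s - G z s) \<le> L * norm (y - z) * exp (K * \<bar>s\<bar>)"
      by (simp add: algebra_simps)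
  qed (simp add: J)
  \<comment> \<open>The Picard operator, conjugated with the exponential weight.\<close>
  define P where "P y t = exp (- (K * \<bar>t\<bar>)) *\<^sub>R (x0 + J y t)" for y t
  have P: "P y \<in> bcontfun" for y
  proof (rule bcontfun_normI)
    have "continuous_on UNIV (J y)"
      by (meson J(2) continuous_at_imp_continuous_on has_vector_derivative_continuous)
    then show "continuous_on UNIV (P y)"
      unfolding P_def by (intro continuous_intros)
    fix t
    have "norm (P y t) \<le> exp (- (K * \<bar>t\<bar>)) * (norm x0 + norm (J y t))"
      by (simp add: P_def norm_triangle_ineq)
    also have "\<dots> \<le> exp (- (K * \<bar>t\<bar>)) *
        (norm x0 * exp (K * \<bar>t\<bar>) + (norm (F 0) + L * norm y) / K * exp (K * \<bar>t\<bar>))"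
      using K J_bound[of y t] by (intro mult_left_mono add_mono) (auto simp: mult_le_cancel_left1)
    also have "\<dots> = norm x0 + (norm (F 0) + L * norm y) / K"
      using mult_exp_exp[of "- (K * \<bar>t\<bar>)" "K * \<bar>t\<bar>"] by (simp add: algebra_simps)
    finally show "norm (P y t) \<le> norm x0 + (norm (F 0) + L * norm y) / K" .
  qed
  have "\<exists>!y. Bcontfun (P y) = y"
  proof (rule banach_fix_type, safe)
    fix y z
    show "dist (Bcontfun (P y)) (Bcontfun (P z)) \<le> 1 / 2 * dist y z"
    proof (rule dist_bound)
      fix t
      have "P y t - P z t = exp (- (K * \<bar>t\<bar>)) *\<^sub>R (J y t - J z t)"
        by (simp add: P_def algebra_simps)
      then have "norm (P y t - P z t) \<le> exp (- (K * \<bar>t\<bar>)) * (L * norm (y - z) / K * exp (K * \<bar>t\<bar>))"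
        using mult_left_mono[OF J_diff[of y t z], of "exp (- (K * \<bar>t\<bar>))"] by simp
      also have "\<dots> = 1 / 2 * dist y z"
        using L mult_exp_exp[of "- (K * \<bar>t\<bar>)" "K * \<bar>t\<bar>"] by (simp add: K_def dist_norm)
      finally show "dist (apply_bcontfun (Bcontfun (P y)) t) (apply_bcontfun (Bcontfun (P z)) t)
          \<le> 1 / 2 * dist y z"
        by (simp add: Bcontfun_inverse P dist_norm)
    qed
  qed auto
  then obtain y where "Bcontfun (P y) = y" by auto
  then have y: "apply_bcontfun y t = P y t" for t
    using Bcontfun_inverse[OF P[of y]] by metis
  have "G y t = F (x0 + J y t)" for t
    using mult_exp_exp[of "- (K * \<bar>t\<bar>)" "K * \<bar>t\<bar>"] by (simp add: G_def y P_def mult.commute)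
  then have "((\<lambda>t. x0 + J y t) has_vector_derivative F (x0 + J y t)) (at t)" for t
    using J(2)[of y t] by (auto intro!: derivative_eq_intros)
  then show ?thesis
    by (intro exI[of _ "\<lambda>t. x0 + J y t"]) (auto simp: J)
qed

text \<open>One inequality serves both directions of time: the two weighted functions
  \<open>exp (- K t) \<phi> t\<close> and \<open>exp (K t) \<phi> t\<close> are monotone on the respective half-intervals.\<close>

lemma gronwall_two_sided:
  fixes \<phi> \<phi>' :: "real \<Rightarrow> real"
  assumes d: "\<And>t. t \<in> {- T..T} \<Longrightarrow> (\<phi> has_real_derivative \<phi>' t) (at t within {- T..T})"
    and b: "\<And>t. t \<in> {- T..T} \<Longrightarrow> \<bar>\<phi>' t\<bar> \<le> K * \<phi> t"
    and t: "t \<in> {- T..T}"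
  shows "\<phi> t \<le> exp (K * \<bar>t\<bar>) * \<phi> 0"
proof (cases "0 \<le> t")
  case True
  have "exp (- (K * t)) * \<phi> t \<le> exp (- (K * 0)) * \<phi> 0"
  proof (rule DERIV_nonpos_imp_decreasing_open[OF True])
    show "continuous_on {0..t} (\<lambda>s. exp (- (K * s)) * \<phi> s)"
    proof (intro continuous_intros)
      show "continuous_on {0..t} \<phi>"
        by (rule continuous_on_subset[of "{- T..T}"])
          (use t in \<open>auto intro: DERIV_continuous_on d\<close>)
    qed
    fix s assume s: "0 < s" "s < t"
    have "(\<phi> has_real_derivative \<phi>' s) (at s)"
      using d[of s] s t by (simp add: at_within_Icc_at)
    then have "((\<lambda>s. exp (- (K * s)) * \<phi> s) has_real_derivative
        exp (- (K * s)) * (\<phi>' s - K * \<phi> s)) (at s)"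
      by (auto intro!: derivative_eq_intros simp: algebra_simps)
    moreover have "\<phi>' s \<le> K * \<phi> s"
      using b[of s] s t by auto
    ultimately show "\<exists>y. ((\<lambda>s. exp (- (K * s)) * \<phi> s) has_real_derivative y) (at s) \<and> y \<le> 0"
      by (auto intro!: exI mult_nonneg_nonpos)
  qed
  then have "exp (K * t) * (exp (- (K * t)) * \<phi> t) \<le> exp (K * t) * \<phi> 0"
    by (intro mult_left_mono) auto
  then show ?thesis
    using True mult_exp_exp[of "K * t" "- (K * t)"] by (simp flip: mult.assoc)
next
  case False
  then have "t \<le> 0" by simp
  have "exp (K * t) * \<phi> t \<le> exp (K * 0) * \<phi> 0"
  proof (rule DERIV_nonneg_imp_increasing_open[OF \<open>t \<le> 0\<close>])
    show "continuous_on {t..0} (\<lambda>s. exp (K * s) * \<phi> s)"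
    proof (intro continuous_intros)
      show "continuous_on {t..0} \<phi>"
        by (rule continuous_on_subset[of "{- T..T}"])
          (use t in \<open>auto intro: DERIV_continuous_on d\<close>)
    qed
    fix s assume s: "t < s" "s < 0"
    have "(\<phi> has_real_derivative \<phi>' s) (at s)"
      using d[of s] s t by (simp add: at_within_Icc_at)
    then have "((\<lambda>s. exp (K * s) * \<phi> s) has_real_derivative
        exp (K * s) * (\<phi>' s + K * \<phi> s)) (at s)"
      by (auto intro!: derivative_eq_intros simp: algebra_simps)
    moreover have "- \<phi>' s \<le> K * \<phi> s"
      using b[of s] s t by auto
    ultimately show "\<exists>y. ((\<lambda>s. exp (K * s) * \<phi> s) has_real_derivative y) (at s) \<and> 0 \<le> y"
      by (auto intro!: exI mult_nonneg_nonneg)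
  qed
  then have "exp (- (K * t)) * (exp (K * t) * \<phi> t) \<le> exp (- (K * t)) * \<phi> 0"
    by (intro mult_left_mono) auto
  then show ?thesis
    using False mult_exp_exp[of "- (K * t)" "K * t"] by (simp flip: mult.assoc)
qed

section \<open>Relative energy for chains with a regular potential\<close>

lemma coord_Abs_ell2_dominated:
  assumes "\<And>n. \<bar>x n\<bar> \<le> C * \<bar>coord v n\<bar>" and "0 \<le> C"
  shows "coord (Abs_ell2 x) = x"
proof -
  obtain u where "\<And>n. coord u n = x n"
    using ell2_of_dominated[OF assms] by metis
  then have "coord u = x" by auto
  then show ?thesis
    using coord_inverse[of u] by simp
qed

text \<open>In the energy estimate \<open>y\<close> is the velocity of the wave. Its supremum norm is of order \<open>\<epsilon>\<close>,
  but its \<open>ell2\<close> norm, which the Cauchy-Schwarz inequality would bring in, is larger because a long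
  wave spreads over about \<open>1 / \<epsilon>\<close> sites. The square summability is therefore drawn from \<open>x\<close>, which
  is quadratic in the perturbation \<open>u\<close>.\<close>

lemma abs_inner_le_weighted:
  assumes "\<And>n. \<bar>coord x n * coord y n\<bar> \<le> B * (coord u n)\<^sup>2"
  shows "\<bar>inner x y\<bar> \<le> B * (norm u)\<^sup>2"
proof -
  have s: "(\<lambda>n. B * (coord u n)\<^sup>2) summable_on UNIV"
    by (intro summable_on_cmult_right square_summable_coord)
  have a: "(\<lambda>n. \<bar>coord x n * coord y n\<bar>) summable_on UNIV"
    by (rule summable_on_comparison_test[OF s]) (use assms in auto)
  have "\<bar>inner x y\<bar> \<le> (\<Sum>\<^sub>\<infinity>n. \<bar>coord x n * coord y n\<bar>)"
    unfolding inner_ell2.rep_eq using norm_infsum_bound[of "\<lambda>n. coord x n * coord y n" UNIV] a by simp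
  also have "\<dots> \<le> (\<Sum>\<^sub>\<infinity>n. B * (coord u n)\<^sup>2)"
    by (rule infsum_mono[OF a s]) (use assms in auto)
  also have "\<dots> = B * (norm u)\<^sup>2"
    by (simp add: norm_ell2_square infsum_cmult_right')
  finally show ?thesis .
qed

lemma has_derivative_of_quadratic_remainder:
  assumes A: "bounded_linear A"
    and r: "\<And>y. norm (f y - f x - A (y - x)) \<le> C * (norm (y - x))\<^sup>2"
  shows "(f has_derivative A) (at x)"
proof (rule has_derivativeI_sandwich[OF zero_less_one A])
  fix y assume "y \<noteq> x"
  then show "norm (f y - f x - A (y - x)) / norm (y - x) \<le> C * norm (y - x)"
    using r[of y] by (simp add: divide_le_eq power2_eq_square)
next
  show "((\<lambda>y. C * norm (y - x)) \<longlongrightarrow> 0) (at x)"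
    by (auto intro!: tendsto_eq_intros)
qed

lemma infsum_difference:
  fixes a b :: "int \<Rightarrow> real"
  assumes "a summable_on UNIV" "b summable_on UNIV"
  shows "(\<lambda>n. a n - b n) summable_on UNIV"
    and "(\<Sum>\<^sub>\<infinity>n. a n - b n) = infsum a UNIV - infsum b UNIV"
proof -
  have "(\<lambda>n. - b n) summable_on UNIV"
    using assms by (simp add: summable_on_uminus)
  from summable_on_add[OF assms(1) this] infsum_add[OF assms(1) this]
  show "(\<lambda>n. a n - b n) summable_on UNIV" "(\<Sum>\<^sub>\<infinity>n. a n - b n) = infsum a UNIV - infsum b UNIV"
    by (simp_all add: infsum_uminus)
qed

text \<open>A potential \<open>G\<close> with force \<open>f = G'\<close> and stiffness \<open>h = G''\<close>. The constant \<open>\<kappa>\<close> bounds the third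
  derivative; it measures how far the chain is from a harmonic one and is of order \<open>\<epsilon>\<^sup>2\<close> in the
  application. The normalisation \<open>m \<le> 1 \<le> M\<close> lets the same constants compare kinetic and
  potential energy with the norms.\<close>

locale regular_potential =
  fixes G f h :: "real \<Rightarrow> real" and m M \<kappa> :: real
  assumes G_deriv: "\<And>x. (G has_real_derivative f x) (at x)"
    and f_deriv: "\<And>x. (f has_real_derivative h x) (at x)"
    and at_zero: "G 0 = 0" "f 0 = 0"
    and m: "0 < m" "m \<le> 1" and M: "1 \<le> M" and \<kappa>: "0 \<le> \<kappa>"
    and h_bounds: "\<And>x. m \<le> h x" "\<And>x. h x \<le> M"
    and h_lipschitz: "\<And>x y. \<bar>h x - h y\<bar> \<le> \<kappa> * \<bar>x - y\<bar>"
begin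

lemma f_lipschitz: "\<bar>f x - f y\<bar> \<le> M * \<bar>x - y\<bar>"
proof -
  have "norm (f x - f y) \<le> M * norm (x - y)"
  proof (rule field_differentiable_bound[of UNIV f h])
    show "norm (h z) \<le> M" for z
      using h_bounds[of z] m by auto
  qed (use f_deriv in auto)
  then show ?thesis by simp
qed

lemma abs_f_le: "\<bar>f x\<bar> \<le> M * \<bar>x\<bar>"
  using f_lipschitz[of x 0] by (simp add: at_zero)

lemma G_remainder:
  "m / 2 * (y - x)\<^sup>2 \<le> G y - G x - f x * (y - x)"
  "G y - G x - f x * (y - x) \<le> M / 2 * (y - x)\<^sup>2"
proof -
  have "\<exists>\<xi>. G y - G x - f x * (y - x) = h \<xi> / 2 * (y - x)\<^sup>2"
  proof (cases "x = y")
    case False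
    define d where "d k = [G, f, h] ! k" for k :: nat
    have "\<exists>\<xi>. (if y < x then y < \<xi> \<and> \<xi> < x else x < \<xi> \<and> \<xi> < y) \<and>
        G y = (\<Sum>k<2. d k x / fact k * (y - x) ^ k) + d 2 \<xi> / fact 2 * (y - x) ^ 2"
    proof (rule Taylor[where a = "min x y" and b = "max x y"])
      show "\<forall>k t. k < 2 \<and> min x y \<le> t \<and> t \<le> max x y \<longrightarrow>
          (d k has_real_derivative d (Suc k) t) (at t)"
        using G_deriv f_deriv by (auto simp: d_def less_2_cases_iff)
    qed (use False in \<open>auto simp: d_def\<close>)
    then obtain \<xi> where "G y = (\<Sum>k<2. d k x / fact k * (y - x) ^ k) + d 2 \<xi> / fact 2 * (y - x) ^ 2"
      by blast
    then have "G y - G x - f x * (y - x) = h \<xi> / 2 * (y - x)\<^sup>2"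
      by (simp add: d_def numeral_2_eq_2)
    then show ?thesis ..
  qed simp
  then obtain \<xi> where "G y - G x - f x * (y - x) = h \<xi> / 2 * (y - x)\<^sup>2" ..
  with h_bounds[of \<xi>] show "m / 2 * (y - x)\<^sup>2 \<le> G y - G x - f x * (y - x)"
    "G y - G x - f x * (y - x) \<le> M / 2 * (y - x)\<^sup>2"
    by (simp_all add: mult_right_mono)
qed

lemma f_remainder: "\<bar>f y - f x - h x * (y - x)\<bar> \<le> \<kappa> * (y - x)\<^sup>2"
proof -
  have "\<exists>\<xi>. \<bar>\<xi> - x\<bar> \<le> \<bar>y - x\<bar> \<and> f y - f x = (y - x) * h \<xi>"
  proof (cases x y rule: linorder_cases)
    case less
    then show ?thesis
      using MVT2[of x y f h] f_deriv by force
  next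
    case greater
    then obtain \<xi> where "y < \<xi>" "\<xi> < x" "f x - f y = (x - y) * h \<xi>"
      using MVT2[of y x f h] f_deriv by blast
    then show ?thesis
      by (intro exI[of _ \<xi>]) (auto simp: algebra_simps)
  qed auto
  then obtain \<xi> where \<xi>: "\<bar>\<xi> - x\<bar> \<le> \<bar>y - x\<bar>" "f y - f x = (y - x) * h \<xi>"
    by blast
  have "\<bar>h \<xi> - h x\<bar> \<le> \<kappa> * \<bar>y - x\<bar>"
    using h_lipschitz[of \<xi> x] \<xi>(1) \<kappa> by (meson mult_left_mono order_trans)
  then have "\<bar>h \<xi> - h x\<bar> * \<bar>y - x\<bar> \<le> \<kappa> * \<bar>y - x\<bar> * \<bar>y - x\<bar>"
    by (rule mult_right_mono) simp
  moreover have "\<bar>f y - f x - h x * (y - x)\<bar> = \<bar>h \<xi> - h x\<bar> * \<bar>y - x\<bar>"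
    using \<xi>(2) by (simp add: abs_mult[symmetric] algebra_simps)
  ultimately show ?thesis
    by (simp add: power2_eq_square abs_mult_self_eq mult.assoc)
qed

definition force_map :: "ell2 \<Rightarrow> ell2" where
  "force_map w = Abs_ell2 (\<lambda>n. f (coord w n))"

definition stiffness :: "ell2 \<Rightarrow> ell2 \<Rightarrow> ell2" where
  "stiffness w u = Abs_ell2 (\<lambda>n. h (coord w n) * coord u n)"

definition potential_energy :: "ell2 \<Rightarrow> real" where
  "potential_energy w = (\<Sum>\<^sub>\<infinity>n. G (coord w n))"

lemma coord_force_map [simp]: "coord (force_map w) n = f (coord w n)"
  unfolding force_map_def using M
  by (subst coord_Abs_ell2_dominated[of _ M w]) (auto simp: abs_f_le)

lemma abs_h_mult_le: "\<bar>h x * y\<bar> \<le> M * \<bar>y\<bar>"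
  using h_bounds[of x] m by (auto simp: abs_mult intro: mult_right_mono)

lemma coord_stiffness [simp]: "coord (stiffness w u) n = h (coord w n) * coord u n"
  unfolding stiffness_def using M
  by (subst coord_Abs_ell2_dominated[of _ M u]) (auto simp: abs_h_mult_le)

lemma force_map_lipschitz: "norm (force_map w - force_map v) \<le> M * norm (w - v)"
  by (rule norm_le_of_coord_le) (use M f_lipschitz in auto)

lemma bounded_linear_stiffness: "bounded_linear (stiffness w)"
proof (rule bounded_linear_intro[where K = M])
  show "norm (stiffness w u) \<le> norm u * M" for u
  proof -
    have "norm (stiffness w u) \<le> M * norm u"
      using M by (intro norm_le_of_coord_le) (auto simp: abs_h_mult_le)
    then show ?thesis by (simp add: mult.commute)
  qed
qed (rule ell2_eqI; simp add: algebra_simps)+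

lemma inner_stiffness: "inner (stiffness w u) v = inner (stiffness w v) u"
  unfolding inner_ell2.rep_eq by (simp add: mult_ac)

text \<open>The quadratic remainder holds in \<open>ell2\<close> because one of its two factors can be estimated in the
  supremum norm, which the \<open>ell2\<close> norm dominates.\<close>

lemma force_map_derivative: "(force_map has_derivative stiffness w) (at w)"
proof (rule has_derivative_of_quadratic_remainder[OF bounded_linear_stiffness])
  fix v
  have "norm (force_map v - force_map w - stiffness w (v - w)) \<le> (\<kappa> * norm (v - w)) * norm (v - w)"
  proof (rule norm_le_of_coord_le)
    fix n
    have "\<bar>coord (force_map v - force_map w - stiffness w (v - w)) n\<bar> \<le> \<kappa> * (coord (v - w) n)\<^sup>2"
      using f_remainder[of "coord v n" "coord w n"] by simp
    also have "\<dots> = \<kappa> * \<bar>coord (v - w) n\<bar> * \<bar>coord (v - w) n\<bar>"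
      by (simp add: power2_eq_square abs_mult_self_eq mult.assoc)
    also have "\<dots> \<le> (\<kappa> * norm (v - w)) * \<bar>coord (v - w) n\<bar>"
      using \<kappa> by (intro mult_right_mono mult_left_mono abs_coord_le_norm) auto
    finally show "\<bar>coord (force_map v - force_map w - stiffness w (v - w)) n\<bar>
        \<le> (\<kappa> * norm (v - w)) * \<bar>coord (v - w) n\<bar>" .
  qed (use \<kappa> in simp)
  then show "norm (force_map v - force_map w - stiffness w (v - w)) \<le> \<kappa> * (norm (v - w))\<^sup>2"
    by (simp add: power2_eq_square mult.assoc)
qed

lemma summable_potential: "(\<lambda>n. G (coord w n)) summable_on UNIV"
proof (rule summable_on_comparison_test)
  show "(\<lambda>n. M / 2 * (coord w n)\<^sup>2) summable_on UNIV"
    by (intro summable_on_cmult_right square_summable_coord)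
  show "G (coord w n) \<le> M / 2 * (coord w n)\<^sup>2" for n
    using G_remainder(2)[where x = 0] by (simp add: at_zero)
  show "0 \<le> G (coord w n)" for n
  proof -
    have "0 \<le> m / 2 * (coord w n)\<^sup>2" using m by simp
    then show ?thesis
      using G_remainder(1)[where x = 0 and y = "coord w n"] by (simp add: at_zero)
  qed
qed

text \<open>The Bregman divergence of the potential energy; convexity makes it comparable to the squared
  distance, and the upper bound also shows that \<open>force_map\<close> is the gradient.\<close>

definition relative_potential :: "ell2 \<Rightarrow> ell2 \<Rightarrow> real" where
  "relative_potential w v =
    potential_energy w - potential_energy v - inner (force_map v) (w - v)"

lemma relative_potential_bounds:
  "m / 2 * (norm (w - v))\<^sup>2 \<le> relative_potential w v"
  "relative_potential w v \<le> M / 2 * (norm (w - v))\<^sup>2"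
proof -
  define r where
    "r n = G (coord w n) - G (coord v n) - f (coord v n) * (coord w n - coord v n)" for n
  have i: "(\<lambda>n. f (coord v n) * (coord w n - coord v n)) summable_on UNIV"
    using summable_coord_mult[of "force_map v" "w - v"] by simp
  have r: "r summable_on UNIV"
    unfolding r_def by (intro infsum_difference(1) summable_potential i)
  have eq: "relative_potential w v = infsum r UNIV"
    unfolding r_def relative_potential_def potential_energy_def inner_ell2.rep_eq
    by (simp add: infsum_difference summable_potential i)
  have s: "(\<lambda>n. c * (coord (w - v) n)\<^sup>2) summable_on UNIV" for c
    by (intro summable_on_cmult_right square_summable_coord)
  have e: "c * (norm (w - v))\<^sup>2 = (\<Sum>\<^sub>\<infinity>n. c * (coord (w - v) n)\<^sup>2)" for c
    by (simp add: norm_ell2_square infsum_cmult_right' del: coord_simps)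
  show "m / 2 * (norm (w - v))\<^sup>2 \<le> relative_potential w v"
    unfolding eq e by (rule infsum_mono[OF s r]) (use G_remainder(1) in \<open>simp add: r_def\<close>)
  show "relative_potential w v \<le> M / 2 * (norm (w - v))\<^sup>2"
    unfolding eq e by (rule infsum_mono[OF r s]) (use G_remainder(2) in \<open>simp add: r_def\<close>)
qed

lemma potential_energy_derivative:
  "(potential_energy has_derivative inner (force_map w)) (at w)"
proof (rule has_derivative_of_quadratic_remainder)
  show "bounded_linear (inner (force_map w))"
    by (rule bounded_linear_inner_right)
  fix v
  have "0 \<le> m / 2 * (norm (v - w))\<^sup>2" using m by simp
  then show "norm (potential_energy v - potential_energy w - inner (force_map w) (v - w))
      \<le> M / 2 * (norm (v - w))\<^sup>2"
    using relative_potential_bounds[of v w] by (simp add: relative_potential_def)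
qed

definition chain_flow :: "real set \<Rightarrow> (real \<Rightarrow> ell2) \<Rightarrow> (real \<Rightarrow> ell2) \<Rightarrow> bool" where
  "chain_flow I w p \<longleftrightarrow> (\<forall>t\<in>I.
    (w has_vector_derivative (shift 1 (p t) - p t)) (at t within I) \<and>
    (p has_vector_derivative (force_map (w t) - shift (-1) (force_map (w t)))) (at t within I))"

lemma chain_flow_exists: "\<exists>w p. w 0 = w0 \<and> p 0 = p0 \<and> chain_flow UNIV w p"
proof -
  define F where
    "F z = (shift 1 (snd z) - snd z, force_map (fst z) - shift (-1) (force_map (fst z)))"
    for z :: "ell2 \<times> ell2"
  have "norm (F x - F y) \<le> (2 + 2 * M) * norm (x - y)" for x y
  proof -
    have n: "norm (fst z) \<le> norm z" "norm (snd z) \<le> norm z" for z :: "ell2 \<times> ell2"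
      by (metis norm_fst_le prod.collapse) (metis norm_snd_le prod.collapse)
    have a: "norm (fst (F x - F y)) \<le> 2 * norm (x - y)"
    proof -
      have "fst (F x - F y) = shift 1 (snd (x - y)) - snd (x - y)"
        by (simp add: F_def shift_diff)
      then show ?thesis
        using norm_shift_minus_self_le[of 1 "snd (x - y)"] n(2)[of "x - y"] by simp
    qed
    have b: "norm (snd (F x - F y)) \<le> 2 * M * norm (x - y)"
    proof -
      define d where "d = force_map (fst x) - force_map (fst y)"
      have "snd (F x - F y) = - (shift (-1) d - d)"
        by (simp add: F_def d_def shift_diff)
      then have "norm (snd (F x - F y)) = norm (shift (-1) d - d)"
        by (simp only: norm_minus_cancel)
      also have "\<dots> \<le> 2 * norm d" by (rule norm_shift_minus_self_le)
      also have "norm d \<le> M * norm (fst (x - y))"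
        using force_map_lipschitz[of "fst x" "fst y"] by (simp add: d_def)
      also have "M * norm (fst (x - y)) \<le> M * norm (x - y)"
        using M n(1)[of "x - y"] by (intro mult_left_mono) auto
      finally show ?thesis by simp
    qed
    have "norm (F x - F y) \<le> norm (fst (F x - F y)) + norm (snd (F x - F y))"
      by (metis norm_Pair_le prod.collapse)
    with a b show ?thesis
      by (simp add: algebra_simps)
  qed
  then obtain z where z: "z 0 = (w0, p0)" "\<And>t. (z has_vector_derivative F (z t)) (at t)"
    using global_solution_of_lipschitz_field[of F "2 + 2 * M" "(w0, p0)"] M by auto
  have "chain_flow UNIV (\<lambda>t. fst (z t)) (\<lambda>t. snd (z t))"
    unfolding chain_flow_def
    using bounded_linear.has_vector_derivative[OF bounded_linear_fst z(2)]
      bounded_linear.has_vector_derivative[OF bounded_linear_snd z(2)]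
    by (simp add: F_def)
  then show ?thesis
    using z(1) by (intro exI[of _ "\<lambda>t. fst (z t)"] exI[of _ "\<lambda>t. snd (z t)"]) simp
qed

definition relative_energy :: "ell2 \<Rightarrow> ell2 \<Rightarrow> ell2 \<Rightarrow> ell2 \<Rightarrow> real" where
  "relative_energy w p v r = (norm (p - r))\<^sup>2 / 2 + relative_potential w v"

text \<open>Both total energies are conserved, so the derivative of the relative energy only sees the
  linear terms subtracted at \<open>(v, r)\<close>. The vector \<open>shift 1 (r t) - r t\<close> is the velocity of \<open>v\<close>.\<close>

lemma relative_energy_derivative:
  assumes w: "chain_flow I w p" and v: "chain_flow I v r" and t: "t \<in> I"
  shows "((\<lambda>s. relative_energy (w s) (p s) (v s) (r s)) has_real_derivative
      inner (force_map (w t) - force_map (v t) - stiffness (v t) (w t - v t))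
        (shift 1 (r t) - r t)) (at t within I)"
proof -
  define w' p' v' r' where
    "w' = shift 1 (p t) - p t" and "p' = force_map (w t) - shift (-1) (force_map (w t))" and
    "v' = shift 1 (r t) - r t" and "r' = force_map (v t) - shift (-1) (force_map (v t))"
  note defs = w'_def p'_def v'_def r'_def
  have d: "(w has_vector_derivative w') (at t within I)" "(p has_vector_derivative p') (at t within I)"
    "(v has_vector_derivative v') (at t within I)" "(r has_vector_derivative r') (at t within I)"
    using w v t by (auto simp: chain_flow_def defs)
  have pot: "((\<lambda>s. potential_energy (x s)) has_vector_derivative inner (force_map (x t)) x')
      (at t within I)" if "(x has_vector_derivative x') (at t within I)" for x x'
    using vector_derivative_diff_chain_within[OF that, of potential_energy "inner (force_map (x t))"]
      potential_energy_derivative[of "x t"] by (simp add: o_def has_derivative_at_withinI)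
  have force: "((\<lambda>s. force_map (v s)) has_vector_derivative stiffness (v t) v') (at t within I)"
    using vector_derivative_diff_chain_within[OF d(3), of force_map "stiffness (v t)"]
      force_map_derivative[of "v t"] by (simp add: o_def has_derivative_at_withinI)
  have inn: "((\<lambda>s. inner (x s) (y s)) has_vector_derivative inner (x t) y' + inner x' (y t))
      (at t within I)"
    if "(x has_vector_derivative x') (at t within I)" "(y has_vector_derivative y') (at t within I)"
    for x y :: "real \<Rightarrow> ell2" and x' y'
    by (rule bounded_bilinear.has_vector_derivative[OF bounded_bilinear_inner that])
  have D: "((\<lambda>s. relative_energy (w s) (p s) (v s) (r s)) has_vector_derivative
      (inner (p t - r t) (p' - r') + inner (p' - r') (p t - r t)) / 2 +
      (inner (force_map (w t)) w' - inner (force_map (v t)) v' -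
       (inner (force_map (v t)) (w' - v') + inner (stiffness (v t) v') (w t - v t)))) (at t within I)"
    unfolding relative_energy_def relative_potential_def power2_norm_eq_inner
    by (intro derivative_intros inn pot force d bounded_linear.has_vector_derivative[OF bounded_linear_divide])
  define g q where "g = force_map (w t) - force_map (v t)" and "q = p t - r t"
  have p': "p' - r' = g - shift (-1) g" and w': "w' - v' = shift 1 q - q"
    by (simp_all add: defs g_def q_def shift_diff)
  \<comment> \<open>Summation by parts: the kinetic energy gained by the perturbation is exactly the potential
    energy it loses through the difference of the forces.\<close>
  have cancel: "inner q (g - shift (-1) g) + inner g (shift 1 q - q) = 0"
    using inner_shift[of 1 q g] by (simp add: inner_diff_right inner_commute)
  have "(inner q (p' - r') + inner (p' - r') q) / 2 +
      (inner (force_map (w t)) w' - inner (force_map (v t)) v' -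
       (inner (force_map (v t)) (w' - v') + inner (stiffness (v t) v') (w t - v t)))
    = inner q (p' - r') + inner g (w' - v') + inner g v' - inner (stiffness (v t) (w t - v t)) v'"
    by (simp add: g_def inner_diff_left inner_diff_right inner_commute[of _ q]
        inner_stiffness[of "v t" "w t - v t" v'] inner_commute[of "p' - r'" q])
  also have "\<dots> = inner (g - stiffness (v t) (w t - v t)) v'"
    using cancel by (simp add: p' w' inner_diff_left)
  finally show ?thesis
    using D unfolding has_real_derivative_iff_has_vector_derivative g_def q_def v'_def by simp
qed

text \<open>The growth rate \<open>2 \<kappa> b / m\<close> is the product of the anharmonicity \<open>\<kappa>\<close> and the speed \<open>b\<close> at which
  the reference solution deforms. Perturbations of every size are covered, since all bounds on the
  potential are global.\<close>

theorem stability_of_slow_solutions: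
  assumes w: "chain_flow {- T..T} w p" and v: "chain_flow {- T..T} v r"
    and slow: "\<And>t n. t \<in> {- T..T} \<Longrightarrow> \<bar>coord (r t) (n + 1) - coord (r t) n\<bar> \<le> b"
    and t: "t \<in> {- T..T}"
  shows "norm (w t - v t) + norm (p t - r t)
    \<le> sqrt (2 * M / m * exp (2 * \<kappa> * b / m * T)) * (norm (w 0 - v 0) + norm (p 0 - r 0))"
proof -
  define E where "E t = relative_energy (w t) (p t) (v t) (r t)" for t
  have b: "0 \<le> b"
    using order_trans[OF abs_ge_zero slow[OF t, of 0]] .
  have lower: "m / 2 * ((norm (w t - v t))\<^sup>2 + (norm (p t - r t))\<^sup>2) \<le> E t"
    and upper: "E t \<le> M / 2 * ((norm (w t - v t))\<^sup>2 + (norm (p t - r t))\<^sup>2)" for t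
  proof -
    have "m * (norm (p t - r t))\<^sup>2 \<le> (norm (p t - r t))\<^sup>2" "(norm (p t - r t))\<^sup>2 \<le> M * (norm (p t - r t))\<^sup>2"
      using m M by (auto simp: mult_le_cancel_right1 mult_le_cancel_right2)
    then show "m / 2 * ((norm (w t - v t))\<^sup>2 + (norm (p t - r t))\<^sup>2) \<le> E t"
      "E t \<le> M / 2 * ((norm (w t - v t))\<^sup>2 + (norm (p t - r t))\<^sup>2)"
      using relative_potential_bounds[where w = "w t" and v = "v t"]
      by (simp_all add: E_def relative_energy_def distrib_left)
  qed
  have growth: "E t \<le> exp (2 * \<kappa> * b / m * \<bar>t\<bar>) * E 0"
  proof (rule gronwall_two_sided[OF _ _ t])
    fix s assume s: "s \<in> {- T..T}"
    show "(E has_real_derivative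
        inner (force_map (w s) - force_map (v s) - stiffness (v s) (w s - v s))
          (shift 1 (r s) - r s)) (at s within {- T..T})"
      unfolding E_def by (rule relative_energy_derivative[OF w v s])
    have "\<bar>inner (force_map (w s) - force_map (v s) - stiffness (v s) (w s - v s))
          (shift 1 (r s) - r s)\<bar> \<le> \<kappa> * b * (norm (w s - v s))\<^sup>2"
    proof (rule abs_inner_le_weighted)
      fix n
      have "\<bar>f (coord (w s) n) - f (coord (v s) n) - h (coord (v s) n) * (coord (w s) n - coord (v s) n)\<bar>
            * \<bar>coord (r s) (n + 1) - coord (r s) n\<bar>
          \<le> \<kappa> * (coord (w s) n - coord (v s) n)\<^sup>2 * b"
        using f_remainder slow[OF s] \<kappa> b by (intro mult_mono) auto
      then show "\<bar>coord (force_map (w s) - force_map (v s) - stiffness (v s) (w s - v s)) n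
            * coord (shift 1 (r s) - r s) n\<bar> \<le> \<kappa> * b * (coord (w s - v s) n)\<^sup>2"
        by (simp add: abs_mult mult_ac)
    qed
    also have "\<dots> \<le> \<kappa> * b * (2 / m * E s)"
    proof (rule mult_left_mono)
      have "m / 2 * (norm (w s - v s))\<^sup>2 \<le> E s"
      proof -
        have "0 \<le> m / 2 * (norm (p s - r s))\<^sup>2"
          using m by simp
        with lower[of s] show ?thesis
          unfolding distrib_left by linarith
      qed
      then show "(norm (w s - v s))\<^sup>2 \<le> 2 / m * E s"
        using m by (simp add: field_simps)
    qed (use \<kappa> b in simp)
    finally show "\<bar>inner (force_map (w s) - force_map (v s) - stiffness (v s) (w s - v s))
        (shift 1 (r s) - r s)\<bar> \<le> 2 * \<kappa> * b / m * E s"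
      by (simp add: mult_ac)
  qed
  define x y where "x = norm (w t - v t) + norm (p t - r t)" and "y = norm (w 0 - v 0) + norm (p 0 - r 0)"
  have nonneg: "0 \<le> x" "0 \<le> y" by (simp_all add: x_def y_def)
  have "x\<^sup>2 \<le> 2 * ((norm (w t - v t))\<^sup>2 + (norm (p t - r t))\<^sup>2)"
    unfolding x_def using zero_le_power2[of "norm (w t - v t) - norm (p t - r t)"]
    by (simp add: power2_sum power2_diff)
  then have "m / 4 * x\<^sup>2 \<le> m / 4 * (2 * ((norm (w t - v t))\<^sup>2 + (norm (p t - r t))\<^sup>2))"
    using m by (intro mult_left_mono) auto
  also have "\<dots> = m / 2 * ((norm (w t - v t))\<^sup>2 + (norm (p t - r t))\<^sup>2)"
    by simp
  also have "\<dots> \<le> E t"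
    by (rule lower)
  also note growth
  also have "exp (2 * \<kappa> * b / m * \<bar>t\<bar>) * E 0 \<le> exp (2 * \<kappa> * b / m * T) * (M / 2 * y\<^sup>2)"
  proof (rule mult_mono)
    show "exp (2 * \<kappa> * b / m * \<bar>t\<bar>) \<le> exp (2 * \<kappa> * b / m * T)"
      unfolding exp_le_cancel_iff by (rule mult_left_mono) (use t \<kappa> b m in auto)
    have "(norm (w 0 - v 0))\<^sup>2 + (norm (p 0 - r 0))\<^sup>2 \<le> y\<^sup>2"
      by (simp add: y_def power2_sum)
    then have "M / 2 * ((norm (w 0 - v 0))\<^sup>2 + (norm (p 0 - r 0))\<^sup>2) \<le> M / 2 * y\<^sup>2"
      using M by (intro mult_left_mono) auto
    with upper[of 0] show "E 0 \<le> M / 2 * y\<^sup>2" by simp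
    have "0 \<le> m / 2 * ((norm (w 0 - v 0))\<^sup>2 + (norm (p 0 - r 0))\<^sup>2)"
      using m by simp
    with lower[of 0] show "0 \<le> E 0" by simp
  qed simp
  finally have "x\<^sup>2 \<le> (2 * M / m * exp (2 * \<kappa> * b / m * T)) * y\<^sup>2"
    using m by (simp add: field_simps)
  then have "sqrt (x\<^sup>2) \<le> sqrt ((2 * M / m * exp (2 * \<kappa> * b / m * T)) * y\<^sup>2)"
    by (rule real_sqrt_le_mono)
  then show ?thesis
    unfolding real_sqrt_mult using nonneg by (simp add: x_def y_def)
qed

end

section \<open>Truncation of the lattice potential\<close>

lemma V'_has_derivative:
  assumes "-1 < x"
  shows "(V' \<epsilon> has_real_derivative (1 + \<epsilon>\<^sup>2) * (1 + x) powr \<epsilon>\<^sup>2) (at x)"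
  unfolding V'_def[abs_def] using assms by (auto intro!: derivative_eq_intros)

lemma V'_lipschitz:
  assumes \<epsilon>: "0 < \<epsilon>" "\<epsilon> \<le> 1" and B: "0 \<le> B" and x: "x \<in> {-1<..B}" and y: "y \<in> {-1<..B}"
  shows "\<bar>V' \<epsilon> x - V' \<epsilon> y\<bar> \<le> 2 * (1 + B) * \<bar>x - y\<bar>"
proof -
  have e: "\<epsilon>\<^sup>2 \<le> 1"
    using \<epsilon> by (simp add: power_le_one)
  have "norm (V' \<epsilon> x - V' \<epsilon> y) \<le> 2 * (1 + B) * norm (x - y)"
  proof (rule field_differentiable_bound[of "{-1<..B}" _ "\<lambda>z. (1 + \<epsilon>\<^sup>2) * (1 + z) powr \<epsilon>\<^sup>2"])
    fix z assume z: "z \<in> {-1<..B}"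
    show "(V' \<epsilon> has_real_derivative (1 + \<epsilon>\<^sup>2) * (1 + z) powr \<epsilon>\<^sup>2) (at z within {-1<..B})"
      using z by (simp add: has_field_derivative_at_within[OF V'_has_derivative])
    have "(1 + z) powr \<epsilon>\<^sup>2 \<le> (1 + B) powr \<epsilon>\<^sup>2"
      using z by (intro powr_mono2) auto
    also have "\<dots> \<le> (1 + B) powr 1"
      using e B by (intro powr_mono) auto
    finally have "(1 + \<epsilon>\<^sup>2) * (1 + z) powr \<epsilon>\<^sup>2 \<le> 2 * (1 + B)"
      using e B by (intro mult_mono) auto
    then show "norm ((1 + \<epsilon>\<^sup>2) * (1 + z) powr \<epsilon>\<^sup>2) \<le> 2 * (1 + B)"
      by simp
  qed (use x y in auto)
  then show ?thesis by simp
qed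

text \<open>The source of the factor \<open>\<epsilon>\<^sup>2\<close> in the third derivative of the potential: the exponent
  itself appears when the power is differentiated.\<close>

lemma powr_square_lipschitz:
  fixes x y \<epsilon> :: real
  assumes \<epsilon>: "0 < \<epsilon>" "\<epsilon> \<le> 1" and x: "1 / 2 \<le> x" and y: "1 / 2 \<le> y"
  shows "\<bar>x powr \<epsilon>\<^sup>2 - y powr \<epsilon>\<^sup>2\<bar> \<le> 2 * \<epsilon>\<^sup>2 * \<bar>x - y\<bar>"
proof -
  have e: "\<epsilon>\<^sup>2 \<le> 1"
    using \<epsilon> by (simp add: power_le_one)
  have "norm (x powr \<epsilon>\<^sup>2 - y powr \<epsilon>\<^sup>2) \<le> 2 * \<epsilon>\<^sup>2 * norm (x - y)"
  proof (rule field_differentiable_bound[of "{1 / 2..}" _ "\<lambda>z. \<epsilon>\<^sup>2 * z powr (\<epsilon>\<^sup>2 - 1)"])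
    fix z :: real assume z: "z \<in> {1 / 2..}"
    show "((\<lambda>z. z powr \<epsilon>\<^sup>2) has_real_derivative \<epsilon>\<^sup>2 * z powr (\<epsilon>\<^sup>2 - 1)) (at z within {1 / 2..})"
      using z by (auto intro!: derivative_eq_intros)
    have "z powr (\<epsilon>\<^sup>2 - 1) \<le> (1 / 2) powr (\<epsilon>\<^sup>2 - 1)"
      using z e by (intro powr_mono2') auto
    also have "\<dots> \<le> (1 / 2) powr (- 1)"
      by (intro powr_mono') auto
    also have "\<dots> = (2 :: real)"
      by (simp add: powr_minus)
    finally have "\<epsilon>\<^sup>2 * z powr (\<epsilon>\<^sup>2 - 1) \<le> \<epsilon>\<^sup>2 * 2"
      by (rule mult_left_mono) simp
    then show "norm (\<epsilon>\<^sup>2 * z powr (\<epsilon>\<^sup>2 - 1)) \<le> 2 * \<epsilon>\<^sup>2"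
      by (simp add: abs_mult)
  qed (use x y in auto)
  then show ?thesis by simp
qed

lemma antiderivative_on_line:
  fixes g :: "real \<Rightarrow> real"
  assumes "\<And>x. isCont g x"
  obtains G where "G 0 = 0" "\<And>x. (G has_real_derivative g x) (at x)"
  using antiderivative_of_continuous[of g] assms
  by (auto simp: continuous_at_imp_continuous_on has_real_derivative_iff_has_vector_derivative)

text \<open>Clamping the argument of the second derivative to \<open>{-1/2..R}\<close> and integrating twice gives a
  potential whose force agrees with \<open>V'\<close> on that interval and is affine on either side of it, with
  all constants uniform in \<open>\<epsilon>\<close> except the anharmonicity \<open>4 \<epsilon>\<^sup>2\<close>.\<close>

lemma truncated_potential:
  assumes \<epsilon>: "0 < \<epsilon>" "\<epsilon> \<le> 1" and R: "0 \<le> R"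
  obtains G f h where "regular_potential G f h (1 / 2) (2 * (1 + R)) (4 * \<epsilon>\<^sup>2)"
    and "\<And>x. x \<in> {- (1 / 2)..R} \<Longrightarrow> f x = V' \<epsilon> x"
proof -
  have e: "\<epsilon>\<^sup>2 \<le> 1"
    using \<epsilon> by (simp add: power_le_one)
  define c where "c x = 1 + max (- (1 / 2)) (min R x)" for x :: real
  define h where "h x = (1 + \<epsilon>\<^sup>2) * c x powr \<epsilon>\<^sup>2" for x
  have c: "1 / 2 \<le> c x" "c x \<le> 1 + R" "\<bar>c x - c y\<bar> \<le> \<bar>x - y\<bar>" for x y
    using R by (auto simp: c_def)
  have h_lip: "\<bar>h x - h y\<bar> \<le> 4 * \<epsilon>\<^sup>2 * \<bar>x - y\<bar>" for x y
  proof -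
    have "\<bar>h x - h y\<bar> = (1 + \<epsilon>\<^sup>2) * \<bar>c x powr \<epsilon>\<^sup>2 - c y powr \<epsilon>\<^sup>2\<bar>"
      by (simp add: h_def abs_mult flip: right_diff_distrib)
    also have "\<dots> \<le> 2 * (2 * \<epsilon>\<^sup>2 * \<bar>c x - c y\<bar>)"
      using e by (intro mult_mono powr_square_lipschitz \<epsilon> c) auto
    also have "\<dots> \<le> 2 * (2 * \<epsilon>\<^sup>2 * \<bar>x - y\<bar>)"
      by (intro mult_left_mono c) auto
    finally show ?thesis by simp
  qed
  have lower: "1 / 2 \<le> h x" for x
  proof -
    have "1 / 2 = (1 / 2 :: real) powr 1"
      by simp
    also have "\<dots> \<le> (1 / 2) powr \<epsilon>\<^sup>2"
      using e by (intro powr_mono') auto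
    also have "\<dots> \<le> c x powr \<epsilon>\<^sup>2"
      using c by (intro powr_mono2) auto
    also have "\<dots> \<le> h x"
      by (simp add: h_def algebra_simps)
    finally show ?thesis .
  qed
  have upper: "h x \<le> 2 * (1 + R)" for x
  proof -
    have "c x powr \<epsilon>\<^sup>2 \<le> (1 + R) powr \<epsilon>\<^sup>2"
      using c[of x] by (intro powr_mono2) auto
    also have "\<dots> \<le> (1 + R) powr 1"
      using e R by (intro powr_mono) auto
    finally show ?thesis
      unfolding h_def using e R by (intro mult_mono) auto
  qed
  have "isCont h x" for x
  proof -
    have "(4 * \<epsilon>\<^sup>2)-lipschitz_on UNIV h"
      using h_lip by (auto simp: lipschitz_on_def dist_real_def)
    then show ?thesis
      using lipschitz_on_continuous_on continuous_on_eq_continuous_at by blast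
  qed
  then obtain f where f: "f 0 = 0" "\<And>x. (f has_real_derivative h x) (at x)"
    using antiderivative_on_line by blast
  obtain G where G: "G 0 = 0" "\<And>x. (G has_real_derivative f x) (at x)"
    using antiderivative_on_line[of f] f(2) DERIV_isCont by blast
  have "\<exists>k. \<forall>x\<in>{- (1 / 2)..R}. f x - V' \<epsilon> x = k"
  proof (rule has_field_derivative_zero_constant)
    fix x assume x: "x \<in> {- (1 / 2)..R}"
    then have "h x = (1 + \<epsilon>\<^sup>2) * (1 + x) powr \<epsilon>\<^sup>2"
      by (simp add: h_def c_def)
    moreover have "((\<lambda>x. f x - V' \<epsilon> x) has_real_derivative
        h x - (1 + \<epsilon>\<^sup>2) * (1 + x) powr \<epsilon>\<^sup>2) (at x)"
      using x by (intro DERIV_diff f V'_has_derivative) auto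
    ultimately show "((\<lambda>x. f x - V' \<epsilon> x) has_real_derivative 0) (at x within {- (1 / 2)..R})"
      by (simp add: has_field_derivative_at_within)
  qed simp
  then obtain k where k: "\<And>x. x \<in> {- (1 / 2)..R} \<Longrightarrow> f x - V' \<epsilon> x = k"
    by blast
  have "k = 0"
    using k[of 0] R f(1) by (simp add: V'_def)
  with k have "\<And>x. x \<in> {- (1 / 2)..R} \<Longrightarrow> f x = V' \<epsilon> x"
    by simp
  moreover have "regular_potential G f h (1 / 2) (2 * (1 + R)) (4 * \<epsilon>\<^sup>2)"
    by standard (use G f lower upper h_lip R in auto)
  ultimately show thesis using that by blast
qed

section \<open>Solutions of the lattice equations\<close>

lemma lattice_solutionD:
  assumes "lattice_solution \<epsilon> I w p"
  shows "C1_on I w" "C1_on I p"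
    and "t \<in> I \<Longrightarrow> -1 < coord (w t) n"
    and "t \<in> I \<Longrightarrow> ((\<lambda>s. coord (w s) n) has_real_derivative
      coord (p t) (n + 1) - coord (p t) n) (at t within I)"
    and "t \<in> I \<Longrightarrow> ((\<lambda>s. coord (p s) n) has_real_derivative
      V' \<epsilon> (coord (w t) n) - V' \<epsilon> (coord (w t) (n - 1))) (at t within I)"
  using assms unfolding lattice_solution_def by blast+

text \<open>The \<open>ell2\<close>-valued derivatives provided by \<open>C1_on\<close> are the ones prescribed coordinatewise by
  the equations, since one-sided derivatives on a nondegenerate interval are unique.\<close>

lemma lattice_solution_derivatives:
  assumes sol: "lattice_solution \<epsilon> {- T..T} w p" and T: "0 < T" and t: "t \<in> {- T..T}"
  obtains w' p' where
    "(w has_vector_derivative w') (at t within {- T..T})"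
    "(p has_vector_derivative p') (at t within {- T..T})"
    "\<And>n. coord w' n = coord (p t) (n + 1) - coord (p t) n"
    "\<And>n. coord p' n = V' \<epsilon> (coord (w t) n) - V' \<epsilon> (coord (w t) (n - 1))"
proof -
  have same: "d = d'"
    if "(g has_real_derivative d) (at t within {- T..T})"
      "(g has_real_derivative d') (at t within {- T..T})" for g d d'
    using vector_derivative_unique_within_closed_interval[of "- T" T t g d d'] T t that
    by (simp add: has_real_derivative_iff_has_vector_derivative cbox_interval)
  obtain w' p' where
    "(w has_vector_derivative w') (at t within {- T..T})"
    "(p has_vector_derivative p') (at t within {- T..T})"
    using lattice_solutionD(1,2)[OF sol] t unfolding C1_on_def by blast
  note d = this
  have "coord w' n = coord (p t) (n + 1) - coord (p t) n" for n
    by (rule same[OF coord_has_real_derivative[OF d(1)] lattice_solutionD(4)[OF sol t]])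
  moreover have "coord p' n = V' \<epsilon> (coord (w t) n) - V' \<epsilon> (coord (w t) (n - 1))" for n
    by (rule same[OF coord_has_real_derivative[OF d(2)] lattice_solutionD(5)[OF sol t]])
  ultimately show thesis using that[OF d] by blast
qed

text \<open>A solution on a compact interval is bounded in \<open>ell2\<close>, hence coordinatewise bounded above, and
  \<open>V'\<close> is Lipschitz on \<open>{-1<..B}\<close> up to the left endpoint, because its derivative
  \<open>(1 + \<epsilon>\<^sup>2) (1 + x) powr \<epsilon>\<^sup>2\<close> stays bounded there. So two solutions can be compared directly,
  without a lower bound on their distance from \<open>-1\<close>.\<close>

lemma lattice_solution_unique:
  assumes sol: "lattice_solution \<epsilon> {- T..T} w p" "lattice_solution \<epsilon> {- T..T} u q"
    and init: "u 0 = w 0" "q 0 = p 0"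
    and \<epsilon>: "0 < \<epsilon>" "\<epsilon> \<le> 1" and T: "0 < T" and t: "t \<in> {- T..T}"
  shows "u t = w t \<and> q t = p t"
proof -
  have bdd: "\<exists>B\<ge>0. \<forall>s\<in>{- T..T}. norm (x s) \<le> B" if "C1_on {- T..T} x" for x
  proof -
    have "continuous_on {- T..T} x"
      using that unfolding C1_on_def by (auto intro: continuous_on_vector_derivative)
    then have "bounded (x ` {- T..T})"
      by (intro compact_imp_bounded compact_continuous_image) auto
    then obtain B where "\<forall>y\<in>x ` {- T..T}. norm y \<le> B"
      unfolding bounded_iff by blast
    then show ?thesis
      by (intro exI[of _ "max 0 B"]) (auto simp: max.coboundedI2)
  qed
  obtain B1 where B1: "0 \<le> B1" "\<forall>s\<in>{- T..T}. norm (w s) \<le> B1"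
    using bdd[OF lattice_solutionD(1)[OF sol(1)]] by blast
  obtain B2 where B2: "0 \<le> B2" "\<forall>s\<in>{- T..T}. norm (u s) \<le> B2"
    using bdd[OF lattice_solutionD(1)[OF sol(2)]] by blast
  define L where "L = 2 * (1 + (B1 + B2))"
  have L: "0 \<le> L"
    using B1 B2 by (simp add: L_def)
  have lip: "\<bar>V' \<epsilon> (coord (u s) n) - V' \<epsilon> (coord (w s) n)\<bar> \<le> L * \<bar>coord (u s) n - coord (w s) n\<bar>"
    if s: "s \<in> {- T..T}" for s n
    unfolding L_def
  proof (rule V'_lipschitz[OF \<epsilon>])
    have "\<bar>coord (u s) n\<bar> \<le> B2" "\<bar>coord (w s) n\<bar> \<le> B1"
      using B1(2) B2(2) s abs_coord_le_norm[of "u s" n] abs_coord_le_norm[of "w s" n] by fastforce+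
    then show "coord (u s) n \<in> {-1<..B1 + B2}" "coord (w s) n \<in> {-1<..B1 + B2}"
      using lattice_solutionD(3)[OF sol(1) s, of n] lattice_solutionD(3)[OF sol(2) s, of n] B1(1) B2(1)
      by auto
  qed (use B1 B2 in auto)
  define \<phi> where "\<phi> s = inner (u s - w s) (u s - w s) + inner (q s - p s) (q s - p s)" for s
  have "\<exists>d. (\<phi> has_real_derivative d) (at s within {- T..T}) \<and> \<bar>d\<bar> \<le> (2 + 2 * L) * \<phi> s"
    if s: "s \<in> {- T..T}" for s
  proof -
    obtain w' p' where w':
      "(w has_vector_derivative w') (at s within {- T..T})"
      "(p has_vector_derivative p') (at s within {- T..T})"
      "\<And>n. coord w' n = coord (p s) (n + 1) - coord (p s) n"
      "\<And>n. coord p' n = V' \<epsilon> (coord (w s) n) - V' \<epsilon> (coord (w s) (n - 1))"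
      using lattice_solution_derivatives[OF sol(1) T s] by blast
    obtain u' q' where u':
      "(u has_vector_derivative u') (at s within {- T..T})"
      "(q has_vector_derivative q') (at s within {- T..T})"
      "\<And>n. coord u' n = coord (q s) (n + 1) - coord (q s) n"
      "\<And>n. coord q' n = V' \<epsilon> (coord (u s) n) - V' \<epsilon> (coord (u s) (n - 1))"
      using lattice_solution_derivatives[OF sol(2) T s] by blast
    define a b where "a = u s - w s" and "b = q s - p s"
    have dom: "\<bar>V' \<epsilon> (coord (u s) n) - V' \<epsilon> (coord (w s) n)\<bar> \<le> L * \<bar>coord a n\<bar>" for n
      using lip[OF s] by (simp add: a_def)
    obtain z where z: "\<And>n. coord z n = V' \<epsilon> (coord (u s) n) - V' \<epsilon> (coord (w s) n)"
      "norm z \<le> L * norm a"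
      using ell2_of_dominated[OF dom L] by blast
    have a': "u' - w' = shift 1 b - b"
      by (rule ell2_eqI) (simp add: u' w' b_def)
    have b': "q' - p' = z - shift (-1) z"
      by (rule ell2_eqI) (simp add: u' w' z)
    have "(\<phi> has_vector_derivative
        (inner a (u' - w') + inner (u' - w') a) + (inner b (q' - p') + inner (q' - p') b))
        (at s within {- T..T})"
      unfolding \<phi>_def a_def b_def
      by (intro derivative_intros bounded_bilinear.has_vector_derivative[OF bounded_bilinear_inner] w' u')
    moreover have "\<bar>(inner a (u' - w') + inner (u' - w') a) + (inner b (q' - p') + inner (q' - p') b)\<bar>
        \<le> (2 + 2 * L) * \<phi> s"
    proof -
      have "\<bar>inner a (u' - w')\<bar> \<le> norm a * (2 * norm b)"
        using Cauchy_Schwarz_ineq2[of a "u' - w'"] mult_left_mono[OF norm_shift_minus_self_le[of 1 b], of "norm a"]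
        by (simp add: a')
      moreover have "\<bar>inner b (q' - p')\<bar> \<le> norm b * (2 * (L * norm a))"
      proof -
        have "norm (q' - p') \<le> 2 * (L * norm a)"
          using norm_shift_minus_self_le[of "-1" z] z(2) by (simp add: b' norm_minus_commute[of z])
        from mult_left_mono[OF this norm_ge_zero[of b]] show ?thesis
          using Cauchy_Schwarz_ineq2[of b "q' - p'"] by linarith
      qed
      ultimately have "\<bar>(inner a (u' - w') + inner (u' - w') a) + (inner b (q' - p') + inner (q' - p') b)\<bar>
          \<le> 2 * (norm a * (2 * norm b)) + 2 * (norm b * (2 * (L * norm a)))"
        by (simp add: inner_commute[of "u' - w'"] inner_commute[of "q' - p'"])
      also have "\<dots> = (2 + 2 * L) * (2 * norm a * norm b)"
        by (simp add: algebra_simps)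
      also have "\<dots> \<le> (2 + 2 * L) * \<phi> s"
        using L sum_squares_bound[of "norm a" "norm b"]
        by (intro mult_left_mono) (auto simp: \<phi>_def a_def b_def power2_norm_eq_inner)
      finally show ?thesis .
    qed
    ultimately show ?thesis
      unfolding has_real_derivative_iff_has_vector_derivative by blast
  qed
  then obtain \<phi>' where \<phi>': "\<And>s. s \<in> {- T..T} \<Longrightarrow> (\<phi> has_real_derivative \<phi>' s) (at s within {- T..T})"
    "\<And>s. s \<in> {- T..T} \<Longrightarrow> \<bar>\<phi>' s\<bar> \<le> (2 + 2 * L) * \<phi> s"
    by metis
  have "\<phi> t \<le> exp ((2 + 2 * L) * \<bar>t\<bar>) * \<phi> 0"
    by (rule gronwall_two_sided[OF \<phi>' t])
  also have "\<phi> 0 = 0"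
    by (simp add: \<phi>_def init)
  finally have "inner (u t - w t) (u t - w t) + inner (q t - p t) (q t - p t) \<le> 0"
    by (simp add: \<phi>_def)
  then have "inner (u t - w t) (u t - w t) = 0 \<and> inner (q t - p t) (q t - p t) = 0"
    using inner_ge_zero[of "u t - w t"] inner_ge_zero[of "q t - p t"] by linarith
  then show ?thesis by simp
qed

context regular_potential
begin

lemma chain_flow_of_lattice_solution:
  assumes sol: "lattice_solution \<epsilon> {- T..T} w p" and T: "0 < T"
    and f: "\<And>t n. t \<in> {- T..T} \<Longrightarrow> f (coord (w t) n) = V' \<epsilon> (coord (w t) n)"
  shows "chain_flow {- T..T} w p"
  unfolding chain_flow_def
proof
  fix t assume t: "t \<in> {- T..T}"
  obtain w' p' where d:
    "(w has_vector_derivative w') (at t within {- T..T})"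
    "(p has_vector_derivative p') (at t within {- T..T})"
    "\<And>n. coord w' n = coord (p t) (n + 1) - coord (p t) n"
    "\<And>n. coord p' n = V' \<epsilon> (coord (w t) n) - V' \<epsilon> (coord (w t) (n - 1))"
    using lattice_solution_derivatives[OF sol T t] by blast
  have "w' = shift 1 (p t) - p t" "p' = force_map (w t) - shift (-1) (force_map (w t))"
    by (rule ell2_eqI; simp add: d f[OF t])+
  with d show "(w has_vector_derivative shift 1 (p t) - p t) (at t within {- T..T}) \<and>
      (p has_vector_derivative force_map (w t) - shift (-1) (force_map (w t))) (at t within {- T..T})"
    by simp
qed

lemma lattice_solution_of_chain_flow:
  assumes flow: "chain_flow I w p"
    and range: "\<And>t n. t \<in> I \<Longrightarrow> -1 < coord (w t) n"
    and f: "\<And>t n. t \<in> I \<Longrightarrow> f (coord (w t) n) = V' \<epsilon> (coord (w t) n)"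
  shows "lattice_solution \<epsilon> I w p"
proof -
  have d: "(w has_vector_derivative (shift 1 (p t) - p t)) (at t within I)"
    "(p has_vector_derivative (force_map (w t) - shift (-1) (force_map (w t)))) (at t within I)"
    if "t \<in> I" for t
    using flow that by (auto simp: chain_flow_def)
  have cont: "continuous_on I w" "continuous_on I p"
    by (rule continuous_on_vector_derivative[OF d(1)], assumption)
      (rule continuous_on_vector_derivative[OF d(2)], assumption)
  have shift_cont: "continuous_on I (\<lambda>t. shift k (x t))" if "continuous_on I x" for k x
    using bounded_linear.continuous_on[OF bounded_linear_shift that] .
  have "M-lipschitz_on UNIV force_map"
    using M force_map_lipschitz by (auto simp: lipschitz_on_def dist_norm)
  then have "continuous_on UNIV force_map"
    by (rule lipschitz_on_continuous_on)
  then have force_cont: "continuous_on I (\<lambda>t. force_map (w t))"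
    using cont(1) by (rule continuous_on_compose2) simp
  have "C1_on I w"
    unfolding C1_on_def by (rule exI[of _ "\<lambda>t. shift 1 (p t) - p t"])
      (auto intro!: d continuous_on_diff shift_cont cont)
  moreover have "C1_on I p"
    unfolding C1_on_def by (rule exI[of _ "\<lambda>t. force_map (w t) - shift (-1) (force_map (w t))"])
      (auto intro!: d continuous_on_diff shift_cont force_cont)
  moreover have "((\<lambda>s. coord (w s) n) has_real_derivative coord (p t) (n + 1) - coord (p t) n)
      (at t within I)" if "t \<in> I" for t n
    using coord_has_real_derivative[OF d(1)[OF that], of n] by simp
  moreover have "((\<lambda>s. coord (p s) n) has_real_derivative
      V' \<epsilon> (coord (w t) n) - V' \<epsilon> (coord (w t) (n - 1))) (at t within I)" if "t \<in> I" for t n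
    using coord_has_real_derivative[OF d(2)[OF that], of n] that by (simp add: f)
  ultimately show ?thesis
    using range by (simp add: lattice_solution_def)
qed

end

section \<open>Uniform bounds on the limit profile\<close>

lemma times_differentiable_2D:
  assumes "times_differentiable 2 f"
  shows "(f has_real_derivative deriv f x) (at x)"
    and "(deriv f has_real_derivative (deriv ^^ 2) f x) (at x)"
proof -
  have "(deriv ^^ 0) f field_differentiable at x" "(deriv ^^ 1) f field_differentiable at x"
    using assms unfolding times_differentiable_def by (metis zero_less_numeral, metis one_less_numeral_iff semiring_norm(76))
  then show "(f has_real_derivative deriv f x) (at x)"
    "(deriv f has_real_derivative (deriv ^^ 2) f x) (at x)"
    by (simp_all add: field_differentiable_derivI numeral_2_eq_2)
qed

text \<open>The exceptional set of an essential bound is open when the function is continuous, and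
  a nonempty open set is not negligible.\<close>

lemma bounded_of_Linf_continuous:
  assumes "f \<in> Linf_space" and cont: "continuous_on UNIV f"
  obtains B where "\<And>x. \<bar>f x\<bar> \<le> B"
proof -
  obtain B where B: "AE x in lebesgue. \<bar>f x\<bar> \<le> B"
    using assms(1) by (auto simp: Linf_space_def)
  have "open {x. B < \<bar>f x\<bar>}"
    by (intro open_Collect_less continuous_intros cont)
  moreover have "negligible {x. B < \<bar>f x\<bar>}"
  proof -
    have "AE x in lebesgue. x \<notin> {x. B < \<bar>f x\<bar>}"
      using B by (simp add: not_less)
    moreover have "{x. B < \<bar>f x\<bar>} \<in> sets lebesgue"
      using \<open>open _\<close> by simp
    ultimately show ?thesis
      by (simp add: negligible_iff_null_sets AE_iff_null_sets)
  qed
  ultimately have "{x. B < \<bar>f x\<bar>} = {}"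
    using open_not_negligible by blast
  then have "\<not> B < \<bar>f x\<bar>" for x
    by blast
  then show thesis
    by (intro that) (simp add: not_less)
qed

text \<open>On every interval of length one the first derivative equals a difference quotient somewhere,
  and from there it changes by at most \<open>B\<close>.\<close>

lemma bounded_derivative_of_bounded_second_derivative:
  fixes f f' f'' :: "real \<Rightarrow> real"
  assumes f: "\<And>x. (f has_real_derivative f' x) (at x)" "\<And>x. (f' has_real_derivative f'' x) (at x)"
    and A: "\<And>x. \<bar>f x\<bar> \<le> A" and B: "\<And>x. \<bar>f'' x\<bar> \<le> B"
  shows "\<bar>f' x\<bar> \<le> 2 * A + B"
proof -
  obtain \<xi> where \<xi>: "x < \<xi>" "\<xi> < x + 1" "f (x + 1) - f x = (x + 1 - x) * f' \<xi>"
    using MVT2[of x "x + 1" f f'] f by auto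
  obtain \<zeta> where \<zeta>: "f' \<xi> - f' x = (\<xi> - x) * f'' \<zeta>"
    using MVT2[of x \<xi> f' f''] f \<xi> by auto
  have "\<bar>(\<xi> - x) * f'' \<zeta>\<bar> \<le> 1 * B"
    unfolding abs_mult using \<xi> B by (intro mult_mono) auto
  then show ?thesis
    using \<xi>(3) \<zeta> A[of x] A[of "x + 1"] by (simp add: abs_le_iff)
qed

text \<open>A single lattice profile \<open>v\<close>, for one fixed \<open>\<epsilon>\<close>, suffices to bound \<open>W\<close>, because every point \<open>x\<close>
  is \<open>\<epsilon> * z\<close> for some \<open>z\<close>.\<close>

lemma limit_profile_bounds:
  assumes W: "limit_profile lam W" and v: "stationary_profile lam W C1 \<epsilon> v"
    and pos: "0 < \<epsilon>" "0 < lam"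
  obtains A B where "0 \<le> A" "\<And>x. W x \<le> A" "\<And>x. \<bar>deriv W x\<bar> \<le> B"
proof -
  have vd: "times_differentiable 2 v" "v \<in> Linf_space"
    and near: "\<And>z. \<bar>v z - W (\<epsilon> * z)\<bar> \<le> C1 * \<epsilon> powr (1 / 6)"
    using v by (simp_all add: stationary_profile_def)
  have Wd: "times_differentiable 2 W" and W0: "\<And>x. 0 < W x"
    and ode: "\<And>x. lam * W x = 1 / 12 * (deriv ^^ 2) W x + (1 + W x) * ln (1 + W x)"
    using W unfolding limit_profile_def by blast+
  have "continuous_on UNIV v"
    using times_differentiable_2D(1)[OF vd(1)] by (meson DERIV_isCont continuous_at_imp_continuous_on)
  then obtain K where K: "\<And>x. \<bar>v x\<bar> \<le> K"
    using bounded_of_Linf_continuous vd(2) by metis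
  define A where "A = K + C1 * \<epsilon> powr (1 / 6)"
  have WA: "W x \<le> A" for x
    using near[of "x / \<epsilon>"] K[of "x / \<epsilon>"] pos by (simp add: A_def abs_le_iff)
  have A: "0 \<le> A"
    using WA[of 0] W0[of 0] by simp
  have second: "\<bar>(deriv ^^ 2) W x\<bar> \<le> 12 * (lam * A + (1 + A) * A)" for x
  proof -
    have "0 \<le> (1 + W x) * ln (1 + W x)"
      using W0[of x] by (intro mult_nonneg_nonneg) auto
    moreover have "(1 + W x) * ln (1 + W x) \<le> (1 + A) * A"
    proof (rule mult_mono)
      show "ln (1 + W x) \<le> A"
        using ln_add_one_self_le_self[of "W x"] W0[of x] WA[of x] by simp
    qed (use W0[of x] WA[of x] A in auto)
    moreover have "0 \<le> lam * W x" "lam * W x \<le> lam * A"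
      using pos W0[of x] WA[of x] by (simp_all add: mult_left_mono)
    ultimately show ?thesis
      using ode[of x] by (simp add: abs_le_iff algebra_simps)
  qed
  have "\<bar>deriv W x\<bar> \<le> 2 * A + 12 * (lam * A + (1 + A) * A)" for x
    by (rule bounded_derivative_of_bounded_second_derivative[OF times_differentiable_2D(1)[OF Wd] times_differentiable_2D(2)[OF Wd] _ second])
      (use W0 WA in \<open>auto simp: abs_of_pos\<close>)
  with A WA that show thesis by blast
qed

section \<open>Long-time stability\<close>

lemma lattice_solution_subset:
  assumes sol: "lattice_solution \<epsilon> I w p" and J: "J \<subseteq> I"
  shows "lattice_solution \<epsilon> J w p"
proof -
  have C1: "C1_on J x" if x: "C1_on I x" for x
  proof -
    obtain x' where x': "\<forall>t\<in>I. (x has_vector_derivative x' t) (at t within I)" "continuous_on I x'"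
      using x unfolding C1_on_def by blast
    then have "\<forall>t\<in>J. (x has_vector_derivative x' t) (at t within J)"
      using J by (auto intro: has_vector_derivative_within_subset)
    moreover have "continuous_on J x'"
      using x'(2) J by (rule continuous_on_subset)
    ultimately show ?thesis
      unfolding C1_on_def by blast
  qed
  show ?thesis
    unfolding lattice_solution_def
    by (intro conjI ballI allI C1 lattice_solutionD[OF sol] DERIV_subset[OF _ J] subsetD[OF J])
qed

text \<open>The scaling enters here: anharmonicity \<open>4 \<epsilon>\<^sup>2\<close>, deformation speed \<open>\<epsilon> \<beta>\<close> and time \<open>\<tau> / \<epsilon>\<^sup>3\<close>
  multiply to a quantity without \<open>\<epsilon>\<close>. The reference solution keeps a distance \<open>1/4\<close> from the ends
  of the range \<open>{-1/2..R}\<close> in which force and truncated force agree, and \<open>small\<close> says that the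
  perturbation never exceeds that distance.\<close>

theorem lattice_stability:
  fixes R \<beta> \<tau> :: real
  assumes R: "0 \<le> R" and \<beta>: "0 \<le> \<beta>" and \<tau>: "0 < \<tau>" and \<epsilon>: "0 < \<epsilon>" "\<epsilon> \<le> 1"
  defines "C \<equiv> sqrt (8 * (1 + R) * exp (16 * \<beta> * \<tau>))" and "T \<equiv> \<tau> / \<epsilon> ^ 3"
  assumes sol: "lattice_solution \<epsilon> {- T..T} v r"
    and range: "\<And>t n. t \<in> {- T..T} \<Longrightarrow> coord (v t) n \<in> {- (1 / 4)..R - 1 / 4}"
    and slow: "\<And>t n. t \<in> {- T..T} \<Longrightarrow> \<bar>coord (r t) (n + 1) - coord (r t) n\<bar> \<le> \<epsilon> * \<beta>"
    and small: "C * (norm (w0 - v 0) + norm (p0 - r 0)) \<le> 1 / 4"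
  shows "\<exists>w p. lattice_solution \<epsilon> {- T..T} w p \<and> w 0 = w0 \<and> p 0 = p0 \<and>
    (\<forall>t\<in>{- T..T}. norm (w t - v t) + norm (p t - r t) \<le> C * (norm (w0 - v 0) + norm (p0 - r 0)))"
proof -
  obtain G f h where reg: "regular_potential G f h (1 / 2) (2 * (1 + R)) (4 * \<epsilon>\<^sup>2)"
    and f: "\<And>x. x \<in> {- (1 / 2)..R} \<Longrightarrow> f x = V' \<epsilon> x"
    using truncated_potential[OF \<epsilon> R] by blast
  interpret regular_potential G f h "1 / 2" "2 * (1 + R)" "4 * \<epsilon>\<^sup>2" by (rule reg)
  have T: "0 < T"
    using \<tau> \<epsilon> by (simp add: T_def)
  have flow_v: "chain_flow {- T..T} v r"
  proof (rule chain_flow_of_lattice_solution[OF sol T])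
    fix t n assume "t \<in> {- T..T}"
    from range[OF this, of n] show "f (coord (v t) n) = V' \<epsilon> (coord (v t) n)"
      by (intro f) auto
  qed
  obtain w p where init: "w 0 = w0" "p 0 = p0" and flow: "chain_flow UNIV w p"
    using chain_flow_exists by blast
  have flow_w: "chain_flow {- T..T} w p"
    using flow unfolding chain_flow_def by (auto intro: has_vector_derivative_at_within)
  have "2 * (4 * \<epsilon>\<^sup>2) * (\<epsilon> * \<beta>) / (1 / 2) * T = 16 * \<beta> * \<tau>"
    using \<epsilon> by (simp add: T_def field_simps power2_eq_square power3_eq_cube)
  then have const: "2 * (2 * (1 + R)) / (1 / 2) * exp (2 * (4 * \<epsilon>\<^sup>2) * (\<epsilon> * \<beta>) / (1 / 2) * T)
      = 8 * (1 + R) * exp (16 * \<beta> * \<tau>)"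
    by (simp only:) simp
  have bound: "norm (w t - v t) + norm (p t - r t) \<le> C * (norm (w0 - v 0) + norm (p0 - r 0))"
    if "t \<in> {- T..T}" for t
    using stability_of_slow_solutions[OF flow_w flow_v slow that] unfolding const init C_def .
  have w_range: "coord (w t) n \<in> {- (1 / 2)..R}" if t: "t \<in> {- T..T}" for t n
  proof -
    have "\<bar>coord (w t - v t) n\<bar> \<le> norm (w t - v t)"
      by (rule abs_coord_le_norm)
    also have "\<dots> \<le> 1 / 4"
      using bound[OF t] small norm_ge_zero[of "p t - r t"] by linarith
    finally have "\<bar>coord (w t) n - coord (v t) n\<bar> \<le> 1 / 4"
      by simp
    moreover have "- (1 / 4) \<le> coord (v t) n" "coord (v t) n \<le> R - 1 / 4"
      using range[OF t, of n] by simp_all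
    ultimately have "- (1 / 2) \<le> coord (w t) n" "coord (w t) n \<le> R"
      by linarith+
    then show ?thesis
      by simp
  qed
  have "lattice_solution \<epsilon> {- T..T} w p"
  proof (rule lattice_solution_of_chain_flow[OF flow_w])
    fix t n assume "t \<in> {- T..T}"
    from w_range[OF this, of n] show "-1 < coord (w t) n" "f (coord (w t) n) = V' \<epsilon> (coord (w t) n)"
      using f by auto
  qed
  with init bound show ?thesis by blast
qed

lemma power_sixth_root_le:
  fixes a \<epsilon> :: real
  assumes "0 < a" "0 < \<epsilon>" "\<epsilon> \<le> a ^ 6"
  shows "\<epsilon> powr (1 / 6) \<le> a"
proof -
  have "\<epsilon> powr (1 / 6) \<le> (a powr 6) powr (1 / 6)"
    using assms by (intro powr_mono2) (auto simp: powr_numeral)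
  also have "\<dots> = a"
    using assms by (simp only: powr_powr) simp
  finally show ?thesis .
qed

theorem theorem2:
  fixes lam \<epsilon>1 C1 :: real
    and C' :: "nat \<Rightarrow> real"
    and W :: "real \<Rightarrow> real"
    and w_stat p_stat :: "real \<Rightarrow> real \<Rightarrow> real"
    and w_trav p_trav :: "real \<Rightarrow> real \<Rightarrow> ell2"
  assumes lam: "lam > 1"
    and W_unique: "\<forall>U. limit_profile lam U \<longleftrightarrow> U = W"
    and W_regular: "smooth W" "W \<in> Sobolev_inf"
    and constants: "\<epsilon>1 > 0" "C1 > 0" "\<forall>k. C' k > 0"
    and w_stat_unique:
      "\<forall>\<epsilon>\<in>{0<..<\<epsilon>1}. \<forall>v. stationary_profile lam W C1 \<epsilon> v \<longleftrightarrow> v = w_stat \<epsilon>"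
    and w_stat_regular:
      "\<forall>\<epsilon>\<in>{0<..<\<epsilon>1}. smooth (w_stat \<epsilon>) \<and> w_stat \<epsilon> \<in> Sobolev_inf"
    and w_stat_derivs:
      "\<forall>\<epsilon>\<in>{0<..<\<epsilon>1}. \<forall>k z.
        \<bar>(deriv ^^ k) (w_stat \<epsilon>) z - \<epsilon> ^ k * (deriv ^^ k) W (\<epsilon> * z)\<bar>
          \<le> C' k * \<epsilon> powr (real k + 1 / 6)"
    and p_stat:
      "\<forall>\<epsilon>\<in>{0<..<\<epsilon>1}. \<forall>z.
        - wave_speed lam \<epsilon> * deriv (w_stat \<epsilon>) z = p_stat \<epsilon> (z + 1) - p_stat \<epsilon> z"
    and w_trav:
      "\<forall>\<epsilon>\<in>{0<..<\<epsilon>1}. \<forall>t n.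
        coord (w_trav \<epsilon> t) n = w_stat \<epsilon> (real_of_int n - wave_speed lam \<epsilon> * t)"
    and p_trav:
      "\<forall>\<epsilon>\<in>{0<..<\<epsilon>1}. \<forall>t n.
        coord (p_trav \<epsilon> t) n = p_stat \<epsilon> (real_of_int n - wave_speed lam \<epsilon> * t)"
    and trav_solution:
      "\<forall>\<epsilon>\<in>{0<..<\<epsilon>1}. lattice_solution \<epsilon> UNIV (w_trav \<epsilon>) (p_trav \<epsilon>)"
  shows
    "\<forall>\<tau>0>0. \<exists>\<epsilon>0 \<delta>0 C0. 0 < \<epsilon>0 \<and> \<epsilon>0 \<le> \<epsilon>1 \<and> 0 < \<delta>0 \<and> 0 < C0 \<and>
      (\<forall>\<epsilon>\<in>{0<..<\<epsilon>0}. \<forall>w_ini p_ini \<delta>.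
        \<delta> = norm (w_ini - w_trav \<epsilon> 0) + norm (p_ini - p_trav \<epsilon> 0) \<and> \<delta> \<le> \<delta>0 \<longrightarrow>
        (\<exists>w p.
          lattice_solution \<epsilon> {- (\<tau>0 / \<epsilon> ^ 3)..\<tau>0 / \<epsilon> ^ 3} w p \<and> w 0 = w_ini \<and> p 0 = p_ini \<and>
          (\<forall>u q.
            lattice_solution \<epsilon> {- (\<tau>0 / \<epsilon> ^ 3)..\<tau>0 / \<epsilon> ^ 3} u q \<and> u 0 = w_ini \<and> q 0 = p_ini \<longrightarrow>
            (\<forall>t\<in>{- (\<tau>0 / \<epsilon> ^ 3)..\<tau>0 / \<epsilon> ^ 3}. u t = w t \<and> q t = p t)) \<and>
          (\<forall>t\<in>{- (\<tau>0 / \<epsilon> ^ 3)..\<tau>0 / \<epsilon> ^ 3}.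
            norm (w t - w_trav \<epsilon> t) + norm (p t - p_trav \<epsilon> t) \<le> C0 * \<delta>)))"
proof (intro allI impI)
  fix \<tau>0 :: real assume \<tau>0: "0 < \<tau>0"
  have W: "limit_profile lam W"
    using W_unique by blast
  then have W_pos: "0 < W x" for x
    unfolding limit_profile_def by blast
  have profile: "stationary_profile lam W C1 \<epsilon> (w_stat \<epsilon>)" if "\<epsilon> \<in> {0<..<\<epsilon>1}" for \<epsilon>
    using w_stat_unique that by blast
  \<comment> \<open>Any admissible parameter would do: a single lattice profile bounds the limit profile.\<close>
  have half: "\<epsilon>1 / 2 \<in> {0<..<\<epsilon>1}"
    using constants(1) by simp
  have "0 < \<epsilon>1 / 2" "0 < lam"
    using constants(1) lam by simp_all
  then obtain A B where A: "0 \<le> A" "\<And>x. W x \<le> A" and B: "\<And>x. \<bar>deriv W x\<bar> \<le> B"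
    using limit_profile_bounds[OF W profile[OF half]] by metis
  have B0: "0 \<le> B"
    using order_trans[OF abs_ge_zero B[of 0]] .
  define \<beta> where "\<beta> = sqrt (1 + lam) * (B + C' 1)"
  define C0 where "C0 = sqrt (8 * (1 + (A + 1)) * exp (16 * \<beta> * \<tau>0))"
  \<comment> \<open>The last bound on \<open>\<epsilon>\<close> gives \<open>C1 * \<epsilon> powr (1 / 6) \<le> 1 / 4\<close>, which keeps the wave above \<open>-1/4\<close>,
    as \<open>W\<close> is positive.\<close>
  define \<epsilon>0 where "\<epsilon>0 = min \<epsilon>1 (min 1 ((1 / (4 * C1)) ^ 6))"
  have C'1: "0 < C' 1"
    using constants(3) by blast
  have \<beta>: "0 \<le> \<beta>"
    using lam B0 C'1 by (simp add: \<beta>_def)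
  have C0: "0 < C0"
    using A by (simp add: C0_def)
  have \<epsilon>0: "0 < \<epsilon>0" "\<epsilon>0 \<le> \<epsilon>1"
    using constants(1,2) by (simp_all add: \<epsilon>0_def)
  have main: "\<exists>w p.
      lattice_solution \<epsilon> {- (\<tau>0 / \<epsilon> ^ 3)..\<tau>0 / \<epsilon> ^ 3} w p \<and> w 0 = w_ini \<and> p 0 = p_ini \<and>
      (\<forall>u q.
        lattice_solution \<epsilon> {- (\<tau>0 / \<epsilon> ^ 3)..\<tau>0 / \<epsilon> ^ 3} u q \<and> u 0 = w_ini \<and> q 0 = p_ini \<longrightarrow>
        (\<forall>t\<in>{- (\<tau>0 / \<epsilon> ^ 3)..\<tau>0 / \<epsilon> ^ 3}. u t = w t \<and> q t = p t)) \<and>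
      (\<forall>t\<in>{- (\<tau>0 / \<epsilon> ^ 3)..\<tau>0 / \<epsilon> ^ 3}.
        norm (w t - w_trav \<epsilon> t) + norm (p t - p_trav \<epsilon> t) \<le> C0 * \<delta>)"
    if \<epsilon>_lt: "\<epsilon> \<in> {0<..<\<epsilon>0}"
      and \<delta>: "\<delta> = norm (w_ini - w_trav \<epsilon> 0) + norm (p_ini - p_trav \<epsilon> 0)" "\<delta> \<le> 1 / (4 * C0)"
    for \<epsilon> w_ini p_ini \<delta>
  proof -
    have \<epsilon>: "0 < \<epsilon>" "\<epsilon> \<le> 1" and \<epsilon>_in: "\<epsilon> \<in> {0<..<\<epsilon>1}" and \<epsilon>_root: "\<epsilon> \<le> (1 / (4 * C1)) ^ 6"
      using \<epsilon>_lt by (auto simp: \<epsilon>0_def)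
    define T where "T = \<tau>0 / \<epsilon> ^ 3"
    have T: "0 < T"
      using \<tau>0 \<epsilon> by (simp add: T_def)
    have near: "\<bar>w_stat \<epsilon> z - W (\<epsilon> * z)\<bar> \<le> 1 / 4" for z
    proof -
      have "C1 * \<epsilon> powr (1 / 6) \<le> C1 * (1 / (4 * C1))"
        using constants(2) \<epsilon> \<epsilon>_root by (intro mult_left_mono power_sixth_root_le) auto
      also have "\<dots> = 1 / 4"
        using constants(2) by simp
      finally have "C1 * \<epsilon> powr (1 / 6) \<le> 1 / 4" .
      moreover have "\<bar>w_stat \<epsilon> z - W (\<epsilon> * z)\<bar> \<le> C1 * \<epsilon> powr (1 / 6)"
        using profile[OF \<epsilon>_in] unfolding stationary_profile_def by blast
      ultimately show ?thesis
        by linarith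
    qed
    have slope: "\<bar>deriv (w_stat \<epsilon>) z\<bar> \<le> \<epsilon> * (B + C' 1)" for z
    proof -
      have "\<bar>(deriv ^^ 1) (w_stat \<epsilon>) z - \<epsilon> ^ 1 * (deriv ^^ 1) W (\<epsilon> * z)\<bar>
          \<le> C' 1 * \<epsilon> powr (real 1 + 1 / 6)"
        using w_stat_derivs \<epsilon>_in by blast
      then have "\<bar>deriv (w_stat \<epsilon>) z - \<epsilon> * deriv W (\<epsilon> * z)\<bar> \<le> C' 1 * \<epsilon> powr (1 + 1 / 6)"
        by simp
      also have "\<dots> \<le> C' 1 * \<epsilon> powr 1"
        using C'1 \<epsilon> by (intro mult_left_mono powr_mono') auto
      finally have "\<bar>deriv (w_stat \<epsilon>) z - \<epsilon> * deriv W (\<epsilon> * z)\<bar> \<le> C' 1 * \<epsilon>"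
        using \<epsilon> by simp
      moreover have "\<bar>\<epsilon> * deriv W (\<epsilon> * z)\<bar> \<le> \<epsilon> * B"
        using B \<epsilon> by (simp add: abs_mult)
      ultimately show ?thesis
        by (simp add: algebra_simps abs_le_iff)
    qed
    have sol: "lattice_solution \<epsilon> {- T..T} (w_trav \<epsilon>) (p_trav \<epsilon>)"
      using trav_solution \<epsilon>_in lattice_solution_subset[OF _ subset_UNIV] by blast
    have range: "coord (w_trav \<epsilon> t) n \<in> {- (1 / 4)..(A + 1) - 1 / 4}" for t n
    proof -
      define z where "z = real_of_int n - wave_speed lam \<epsilon> * t"
      have "coord (w_trav \<epsilon> t) n = w_stat \<epsilon> z"
        using w_trav \<epsilon>_in by (simp add: z_def)
      moreover have "- (1 / 4) \<le> w_stat \<epsilon> z" "w_stat \<epsilon> z \<le> (A + 1) - 1 / 4"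
        using near[of z] W_pos[of "\<epsilon> * z"] A(2)[of "\<epsilon> * z"] by linarith+
      ultimately show ?thesis
        by simp
    qed
    have slow: "\<bar>coord (p_trav \<epsilon> t) (n + 1) - coord (p_trav \<epsilon> t) n\<bar> \<le> \<epsilon> * \<beta>" for t n
    proof -
      define z where "z = real_of_int n - wave_speed lam \<epsilon> * t"
      have "coord (p_trav \<epsilon> t) (n + 1) - coord (p_trav \<epsilon> t) n = p_stat \<epsilon> (z + 1) - p_stat \<epsilon> z"
        using p_trav \<epsilon>_in by (simp add: z_def algebra_simps)
      also have "\<dots> = - wave_speed lam \<epsilon> * deriv (w_stat \<epsilon>) z"
        using p_stat \<epsilon>_in by simp
      also have "\<bar>\<dots>\<bar> = wave_speed lam \<epsilon> * \<bar>deriv (w_stat \<epsilon>) z\<bar>"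
        using lam by (simp add: wave_speed_def abs_mult)
      also have "\<dots> \<le> sqrt (1 + lam) * (\<epsilon> * (B + C' 1))"
      proof (rule mult_mono[OF _ slope])
        have "\<epsilon>\<^sup>2 * lam \<le> 1 * lam"
          using \<epsilon> lam by (intro mult_right_mono) (auto simp: power_le_one)
        then show "wave_speed lam \<epsilon> \<le> sqrt (1 + lam)"
          by (simp add: wave_speed_def)
      qed (use lam in auto)
      finally show ?thesis
        by (simp add: \<beta>_def mult_ac)
    qed
    have "C0 * \<delta> \<le> C0 * (1 / (4 * C0))"
      using C0 \<delta>(2) by (intro mult_left_mono) auto
    then have small: "C0 * (norm (w_ini - w_trav \<epsilon> 0) + norm (p_ini - p_trav \<epsilon> 0)) \<le> 1 / 4"
      using C0 by (simp add: \<delta>(1))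
    obtain w p where wp: "lattice_solution \<epsilon> {- T..T} w p" "w 0 = w_ini" "p 0 = p_ini"
      "\<forall>t\<in>{- T..T}. norm (w t - w_trav \<epsilon> t) + norm (p t - p_trav \<epsilon> t) \<le> C0 * \<delta>"
      using lattice_stability[of "A + 1" \<beta> \<tau>0 \<epsilon> "w_trav \<epsilon>" "p_trav \<epsilon>" w_ini p_ini] A(1) \<beta> \<tau>0 \<epsilon>
        sol range slow small
      unfolding C0_def[symmetric] T_def[symmetric] \<delta>(1)[symmetric] by auto
    have "\<forall>t\<in>{- T..T}. u t = w t \<and> q t = p t"
      if uq: "lattice_solution \<epsilon> {- T..T} u q \<and> u 0 = w_ini \<and> q 0 = p_ini" for u q
    proof -
      have "lattice_solution \<epsilon> {- T..T} u q" "u 0 = w 0" "q 0 = p 0"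
        using uq wp(2,3) by simp_all
      then show ?thesis
        using lattice_solution_unique[OF wp(1) _ _ _ \<epsilon> T] by blast
    qed
    with wp show ?thesis
      unfolding T_def[symmetric] by blast
  qed
  show "\<exists>\<epsilon>0 \<delta>0 C0. 0 < \<epsilon>0 \<and> \<epsilon>0 \<le> \<epsilon>1 \<and> 0 < \<delta>0 \<and> 0 < C0 \<and>
      (\<forall>\<epsilon>\<in>{0<..<\<epsilon>0}. \<forall>w_ini p_ini \<delta>.
        \<delta> = norm (w_ini - w_trav \<epsilon> 0) + norm (p_ini - p_trav \<epsilon> 0) \<and> \<delta> \<le> \<delta>0 \<longrightarrow>
        (\<exists>w p.
          lattice_solution \<epsilon> {- (\<tau>0 / \<epsilon> ^ 3)..\<tau>0 / \<epsilon> ^ 3} w p \<and> w 0 = w_ini \<and> p 0 = p_ini \<and>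
          (\<forall>u q.
            lattice_solution \<epsilon> {- (\<tau>0 / \<epsilon> ^ 3)..\<tau>0 / \<epsilon> ^ 3} u q \<and> u 0 = w_ini \<and> q 0 = p_ini \<longrightarrow>
            (\<forall>t\<in>{- (\<tau>0 / \<epsilon> ^ 3)..\<tau>0 / \<epsilon> ^ 3}. u t = w t \<and> q t = p t)) \<and>
          (\<forall>t\<in>{- (\<tau>0 / \<epsilon> ^ 3)..\<tau>0 / \<epsilon> ^ 3}.
            norm (w t - w_trav \<epsilon> t) + norm (p t - p_trav \<epsilon> t) \<le> C0 * \<delta>)))"
    using main \<epsilon>0 C0 by (intro exI[of _ \<epsilon>0] exI[of _ "1 / (4 * C0)"] exI[of _ C0]) simp
qed

end
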